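(* Let the sequences be generated by the HAP-PRS-SQP algorithm described in the context. Let $\Omega$ and $\hat\Omega$ denote the sets of cluster points of $\{w_k\}$ and $\{\hat w_k\}$, respectively. Suppose that Assumptions 1 and 2 (stated in the context) hold. Then: (i) The whole sequence $\{\hat L_\beta(\hat w_k)\}$ is convergent, and $\hat L_\beta(\hat w_* )=\lim_{k\to\infty}\hat L_\beta(\hat w_k)=\inf_{k}\hat L_\beta(\hat w_k)$ for all $\hat w_*\in\hat\Omega$, the infimum being over the whole sequence $k=0,1,2,\dots$. Therefore $\hat L_\beta$ is finite and constant on $\hat\Omega$. (ii) $\lim_{k\to\infty}\|d_k^x\|=\lim_{k\to\infty}\|d_k^y\|=0$ and $\sum_{k=0}^{+\infty}\|w_{k+1}-w_k\|^2<+\infty$. (iii) $\Omega$ and $\hat\Omega$ are nonempty compact sets, and $d(w_k,\Omega)\to0$ and $d(\hat w_k,\hat\Omega)\to0$ as $k\to\infty$. (iv) $\Omega\subseteq\mathrm{crit}\,L_\beta$ (so the algorithm is globally convergent). (v) $\hat\Omega=\{(x_*,y_*,\lambda_*,0):(x_*,y_*,\lambda_* )\in\Omega\}=\Omega\times\{0\}$.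
   Context: Problem: $f:\mathbb{R}^{n_1}\to\mathbb{R}$ and $g:\mathbb{R}^{n_2}\to\mathbb{R}$ are continuously differentiable (not necessarily convex), $A\in\mathbb{R}^{n_2\times n_1}$; consider $\min_{x,y}\{f(x)+g(y):\ Ax=y\}$. For $\beta>0$ and $w=(x,y,\lambda)$, the augmented Lagrangian is $L_\beta(w)=f(x)+g(y)-\lambda^\top(Ax-y)+\frac{\beta}{2}\|Ax-y\|^2$; $\mathrm{crit}\,L_\beta=\{w:\nabla L_\beta(w)=0\}$. For symmetric $S$, $\|x\|_S^2=x^\top Sx$; $\|\cdot\|$ is the Euclidean norm on vectors and the spectral norm on matrices; $\lambda_{\min},\lambda_{\max}$ denote extreme eigenvalues; $d(x,Q)=\inf_{y\in Q}\|y-x\|$. HAP-PRS-SQP algorithm. Parameters: $\rho,\nu\in(0,1)$, $\alpha\in(-1,\frac1\rho-1)$, $\beta,\ell,\sigma>0$, $r,s\in\mathbb{R}$ with $r+s\neq0$; starting point $w_0=(x_0,y_0,\lambda_0)$. $H_k^x\in\mathbb{R}^{n_1\times n_1}$ and $H_k^y\in\mathbb{R}^{n_2\times n_2}$ are symmetric ($H_0^x,H_0^y$ positive definite) with $\mathcal{H}_k^x:=H_k^x+\beta A^\top A+\ell I\succ0$ and $\mathcal{H}_k^y:=H_k^y+(\beta+\sigma)I\succ0$ for all $k$. For $k=0,1,2,\dots$: (1) $\tilde x_{k+1}=\arg\min_x\{\nabla f(x_k)^\top(x-x_k)+\frac12\|x-x_k\|^2_{H_k^x}-\lambda_k^\top(Ax-y_k)+\frac\beta2\|Ax-y_k\|^2+\frac\ell2\|x-x_k\|^2\}$;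 $\bar x_{k+1}=\tilde x_{k+1}+\alpha(\tilde x_{k+1}-x_k)$; $d_k^x=\bar x_{k+1}-x_k$; $t_k^x=\nu^{i}$ with $i$ the smallest nonnegative integer such that $L_\beta(x_k+\nu^i d_k^x,y_k,\lambda_k)\le L_\beta(x_k,y_k,\lambda_k)-\rho\nu^i\|d_k^x\|^2_{\mathcal{H}_k^x}$; $x_{k+1}=x_k+t_k^xd_k^x$. (2) $\lambda_{k+\frac12}=\lambda_k-r\beta(Ax_{k+1}-y_k)$. (3) $\tilde y_{k+1}=\arg\min_y\{\nabla g(y_k)^\top(y-y_k)+\frac12\|y-y_k\|^2_{H_k^y}-\lambda_{k+\frac12}^\top(Ax_{k+1}-y)+\frac\beta2\|Ax_{k+1}-y\|^2+\frac\sigma2\|y-y_k\|^2\}$; $\bar y_{k+1}=\tilde y_{k+1}+\alpha(\tilde y_{k+1}-y_k)$; $d_k^y=\bar y_{k+1}-y_k$; $t_k^y=\nu^i$ with $i$ the smallest nonnegative integer such that $L_\beta(x_{k+1},y_k+\nu^id_k^y,\lambda_{k+\frac12})\le L_\beta(x_{k+1},y_k,\lambda_{k+\frac12})-\rho\nu^i\|d_k^y\|^2_{\mathcal{H}_k^y}$; $y_{k+1}=y_k+t_k^yd_k^y$. (4) $\lambda_{k+1}=\lambda_{k+\frac12}-s\beta(Ax_{k+1}-y_{k+1})$, $w_{k+1}=(x_{k+1},y_{k+1},\lambda_{k+1})$. (The algorithm stops when $w_{k+1}=w_k$; the sequences here are the infinite ones obtained by running without the stopping test.) Conventions for index $-1$: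 $y_{-1}=\bar y_0=\tilde y_0=y_0$ and $\mathcal{H}_{-1}^y=\mathcal{H}_0^y$; hence $d_{-1}^y=\bar y_0-y_{-1}=0$. Assumption 1: (i) $\{w_k\}$ is bounded, and $\|H_k^x\|\le\eta^x$, $\|H_k^y\|\le\eta^y$ for all $k$. (ii) There are lower bounds $\underline\lambda^x$ of $\{\lambda_{\min}(H_k^x)\}$ and $\underline\lambda^y$ of $\{\lambda_{\min}(H_k^y)\}$ such that $\eta_1^x:=\underline\lambda^x+\beta\lambda_{\min}(A^\top A)+\ell>0$ and $\eta_1^y:=\underline\lambda^y+\beta+\sigma>0$. (iii) $\nabla f$ and $\nabla g$ are locally Lipschitz continuous. Constants: $\eta_2^y:=\eta^y+\beta+\sigma$. Let $\mathcal{S}^x\subset\mathbb{R}^{n_1}$, $\mathcal{S}^y\subset\mathbb{R}^{n_2}$ be compact sets with $x_k+td_k^x\in\mathcal{S}^x$, $y_k+td_k^y\in\mathcal{S}^y$ for all $t\in[0,1]$ and all $k$ (they exist under Assumption 1), and let $L_f,L_g>0$ be Lipschitz constants of $\nabla f$ on $\mathcal{S}^x$ and of $\nabla g$ on $\mathcal{S}^y$. Set $$\gamma:=\nu\min\left\{1,\frac{(\frac{1}{1+\alpha}-\rho)\eta_1^{x}}{L_f+\beta\|A^{\top}A\|},\frac{(\frac{1}{1+\alpha}-\rho)\eta_1^y}{L_g+\beta}\right\},$$ $$\delta^y =\rho\gamma\eta^y_1 -\frac{6}{|r+s|\beta}\left(L_{g}^{2}+(1+s^{2})\beta^{2}+2\left(\frac{\eta_2^y}{1+\alpha}\right)^2\right)-\frac{|rs|\beta}{|r+s|},\quad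 \delta^x=\rho\gamma\eta^x_1-\frac{6(1-s)^2\beta\lambda_{\max}(A^{\top}A)}{|r+s|}.$$ Assumption 2: the parameters are chosen such that $\delta^x>0$ and $\delta^y>0$. Merit function: for $\hat w=(w,d^y)$, $\hat L_\beta(\hat w):=L_\beta(w)+\frac{6}{|r+s|\beta}\left(L_g^2+\beta^2+\left(\frac{\eta_2^y}{1+\alpha}\right)^2\right)\|d^y\|^2$, and $\hat w_k=(w_k,d_{k-1}^y)$.
   Formalization: In (i), limit = infimum over k≥0 fails for some λ_0; proved instead: limit = infimum over k≥1 always, and over k≥0 if the y-step and multiplier update also hold at index −1, i.e. λ_0 = −∇g(y_0)+(1−s)β(Ax_0−y_0). *)

theory Defs
  imports "HOL-Analysis.Analysis"
begin

definition pos_def :: "real^'n^'n \<Rightarrow> bool" where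
  "pos_def S \<longleftrightarrow> transpose S = S \<and> (\<forall>v. v \<noteq> 0 \<longrightarrow> 0 < v \<bullet> (S *v v))"

definition sq_norm :: "real^'n^'n \<Rightarrow> real^'n \<Rightarrow> real" where
  "sq_norm S v = v \<bullet> (S *v v)"

abbreviation spectral_norm :: "real^'n^'m \<Rightarrow> real" where
  "spectral_norm S \<equiv> onorm ((*v) S)"

definition eigenvalues :: "real^'n^'n \<Rightarrow> real set" where
  "eigenvalues S = {\<mu>. \<exists>v. v \<noteq> 0 \<and> S *v v = \<mu> *\<^sub>R v}"

definition lambda_min :: "real^'n^'n \<Rightarrow> real" where
  "lambda_min S = Min (eigenvalues S)"

definition lambda_max :: "real^'n^'n \<Rightarrow> real" where
  "lambda_max S = Max (eigenvalues S)"

definition locally_lipschitz :: "('a::metric_space \<Rightarrow> 'b::metric_space) \<Rightarrow> bool" where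
  "locally_lipschitz F \<longleftrightarrow> (\<forall>z. \<exists>e>0. \<exists>L. L-lipschitz_on (ball z e) F)"

definition cluster_points :: "(nat \<Rightarrow> 'a::topological_space) \<Rightarrow> 'a set" where
  "cluster_points X = {p. \<exists>\<phi>. strict_mono \<phi> \<and> (X \<circ> \<phi>) \<longlonglongrightarrow> p}"

definition crit :: "('a::real_inner \<Rightarrow> real) \<Rightarrow> 'a set" where
  "crit F = {w. GDERIV F w :> 0}"

definition aug_lagrangian ::
  "(real^'n \<Rightarrow> real) \<Rightarrow> (real^'m \<Rightarrow> real) \<Rightarrow> real^'n^'m \<Rightarrow> real
    \<Rightarrow> (real^'n) \<times> (real^'m) \<times> (real^'m) \<Rightarrow> real" where
  "aug_lagrangian f g A \<beta> = (\<lambda>(x, y, l).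
     f x + g y - l \<bullet> (A *v x - y) + \<beta> / 2 * (norm (A *v x - y))\<^sup>2)"

definition cal_Hx :: "real^'n^'m \<Rightarrow> real \<Rightarrow> real \<Rightarrow> real^'n^'n \<Rightarrow> real^'n^'n" where
  "cal_Hx A \<beta> ell H = H + \<beta> *\<^sub>R (transpose A ** A) + ell *\<^sub>R mat 1"

definition cal_Hy :: "real \<Rightarrow> real \<Rightarrow> real^'m^'m \<Rightarrow> real^'m^'m" where
  "cal_Hy \<beta> \<sigma> H = H + (\<beta> + \<sigma>) *\<^sub>R mat 1"

text \<open>Objectives of the two quadratic subproblems; \<open>c\<close> is the gradient of the smooth term
  at the current point \<open>x0\<close> (respectively \<open>y0\<close>).\<close>

definition x_model ::
  "real^'n^'m \<Rightarrow> real \<Rightarrow> real \<Rightarrow> real^'n \<Rightarrow> real^'n^'n \<Rightarrow> real^'n \<Rightarrow> real^'m \<Rightarrow> real^'m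
    \<Rightarrow> real^'n \<Rightarrow> real" where
  "x_model A \<beta> ell c H x0 y0 l x =
     c \<bullet> (x - x0) + 1/2 * sq_norm H (x - x0) - l \<bullet> (A *v x - y0)
       + \<beta> / 2 * (norm (A *v x - y0))\<^sup>2 + ell / 2 * (norm (x - x0))\<^sup>2"

definition y_model ::
  "real^'n^'m \<Rightarrow> real \<Rightarrow> real \<Rightarrow> real^'m \<Rightarrow> real^'m^'m \<Rightarrow> real^'n \<Rightarrow> real^'m \<Rightarrow> real^'m
    \<Rightarrow> real^'m \<Rightarrow> real" where
  "y_model A \<beta> \<sigma> c H x1 y0 l y =
     c \<bullet> (y - y0) + 1/2 * sq_norm H (y - y0) - l \<bullet> (A *v x1 - y)
       + \<beta> / 2 * (norm (A *v x1 - y))\<^sup>2 + \<sigma> / 2 * (norm (y - y0))\<^sup>2"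

definition armijo_step ::
  "real \<Rightarrow> real \<Rightarrow> (real^'n \<Rightarrow> real) \<Rightarrow> real^'n^'n \<Rightarrow> real^'n \<Rightarrow> real^'n \<Rightarrow> real" where
  "armijo_step \<rho> \<nu> F S z d =
     \<nu> ^ (LEAST i. F (z + \<nu> ^ i *\<^sub>R d) \<le> F z - \<rho> * \<nu> ^ i * sq_norm S d)"

text \<open>The \<open>y\<close>-step and the second multiplier update at index \<open>-1\<close>, under the conventions that
  the iterate, the subproblem solution and the relaxed point of that step all equal \<open>y0\<close>
  (so the step does not move) and that its matrix is \<open>H\<close>, the matrix of index \<open>0\<close>. By
  first-order optimality this forces
  \<open>l0 = - c + (1 - s) * \<beta> * (A *v x0 - y0)\<close>, with \<open>c\<close> the gradient of \<open>g\<close> at \<open>y0\<close>.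
  Descent of the merit function from index 0 to index 1 relies on this identity: for other
  starting multipliers the merit value at index 0 can lie strictly below the limit of the
  merit values.\<close>

definition y_step_at_minus_one ::
  "real^'n^'m \<Rightarrow> real \<Rightarrow> real \<Rightarrow> real \<Rightarrow> real^'m \<Rightarrow> real^'m^'m \<Rightarrow> real^'n \<Rightarrow> real^'m \<Rightarrow> real^'m
    \<Rightarrow> bool" where
  "y_step_at_minus_one A \<beta> \<sigma> s c H x0 y0 l0 \<longleftrightarrow>
     (\<exists>lh. is_arg_min (y_model A \<beta> \<sigma> c H x0 y0 lh) (\<lambda>_. True) y0 \<and>
           l0 = lh - (s * \<beta>) *\<^sub>R (A *v x0 - y0))"

definition merit ::
  "((real^'n) \<times> (real^'m) \<times> (real^'m) \<Rightarrow> real) \<Rightarrow> real \<Rightarrow> real \<Rightarrow> real \<Rightarrow> real \<Rightarrow> real \<Rightarrow> real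
    \<Rightarrow> ((real^'n) \<times> (real^'m) \<times> (real^'m)) \<times> (real^'m) \<Rightarrow> real" where
  "merit L \<beta> \<alpha> r s Lg \<eta>2y = (\<lambda>(w, d).
     L w + 6 / (\<bar>r + s\<bar> * \<beta>) * (Lg\<^sup>2 + \<beta>\<^sup>2 + (\<eta>2y / (1 + \<alpha>))\<^sup>2) * (norm d)\<^sup>2)"

end

theory Submission
  imports Defs
begin

text \<open>
  First-order optimality of the two subproblems turns the slope of \<open>L\<^sub>\<beta>\<close> along the directions
  \<open>d\<^sup>x\<close>, \<open>d\<^sup>y\<close> into a negative multiple of their \<open>\<H>\<close>-norms, so the Armijo steps are at least
  \<open>\<gamma>\<close> and each line search lowers \<open>L\<^sub>\<beta>\<close> by at least \<open>\<rho>\<gamma>\<eta>\<^sub>1|d|\<^sup>2\<close>. The two multiplier updates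
  raise it by \<open>\<beta>(r|u|\<^sup>2 + s|v|\<^sup>2)\<close> with \<open>u = Ax\<^sub>k\<^sub>+\<^sub>1 - y\<^sub>k\<close> and \<open>v = Ax\<^sub>k\<^sub>+\<^sub>1 - y\<^sub>k\<^sub>+\<^sub>1\<close>, and
  \<open>(r + s)(r|u|\<^sup>2 + s|v|\<^sup>2) = |ru + sv|\<^sup>2 + rs|u - v|\<^sup>2\<close> bounds this by
  \<open>|\<lambda>\<^sub>k\<^sub>+\<^sub>1 - \<lambda>\<^sub>k|\<^sup>2\<close> and \<open>|d\<^sup>y|\<^sup>2\<close>. Optimality in \<open>y\<close> at two consecutive indices writes
  \<open>\<lambda>\<^sub>k\<^sub>+\<^sub>1 - \<lambda>\<^sub>k\<close> as a sum of six vectors controlled by the current directions and the previous \<open>d\<^sup>y\<close>;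
  the extra term of the merit function absorbs the latter. Hence the merit function decreases by
  \<open>\<delta>\<^sup>x|d\<^sup>x|\<^sup>2 + \<delta>\<^sup>y|d\<^sup>y|\<^sup>2\<close> per iteration, the directions are square summable, and every cluster
  point is stationary.
\<close>

subsection \<open>Quadratic forms and extreme eigenvalues\<close>

lemma inner_symmetric_matrix:
  fixes S :: "real^'n^'n"
  assumes "transpose S = S"
  shows "u \<bullet> (S *v v) = (S *v u) \<bullet> v"
  by (metis assms dot_lmul_matrix vector_transpose_matrix)

lemma has_derivative_sq_norm [derivative_intros]:
  fixes S :: "real^'n^'n"
  assumes S: "transpose S = S" and g: "(g has_derivative g') (at x within T)"
  shows "((\<lambda>x. sq_norm S (g x)) has_derivative (\<lambda>h. 2 * (g' h \<bullet> (S *v g x)))) (at x within T)"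
proof -
  have "((\<lambda>x. g x \<bullet> (S *v g x)) has_derivative
      (\<lambda>h. g x \<bullet> (S *v g' h) + g' h \<bullet> (S *v g x))) (at x within T)"
    by (intro has_derivative_inner g
        bounded_linear.has_derivative[OF matrix_vector_mul_bounded_linear])
  moreover have "g x \<bullet> (S *v v) = v \<bullet> (S *v g x)" for v
    using inner_symmetric_matrix[OF S, of "g x" v] by (simp add: inner_commute)
  ultimately show ?thesis by (simp add: sq_norm_def)
qed

lemma gradient_eq_0_at_minimum:
  assumes "GDERIV F u :> D" and "\<And>v. F u \<le> F v"
  shows "D = 0"
proof -
  have "(\<lambda>h. h \<bullet> D) = (\<lambda>h. 0)"
    using assms by (intro has_derivative_local_min[of F _ u]) (auto simp: gderiv_def)
  from fun_cong[OF this, of D] show ?thesis by simp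
qed

text \<open>Eigenvectors of a symmetric matrix for distinct eigenvalues are orthogonal, so choosing
  one per eigenvalue embeds the spectrum into a pairwise orthogonal, hence finite, set. Finiteness
  gives \<open>Min\<close> and \<open>Max\<close> in \<open>lambda_min\<close> and
  \<open>lambda_max\<close> their intended meaning.\<close>

lemma finite_eigenvalues:
  fixes S :: "real^'n^'n"
  assumes S: "transpose S = S"
  shows "finite (eigenvalues S)"
proof -
  define e where "e = (\<lambda>\<mu>. SOME v. v \<noteq> 0 \<and> S *v v = \<mu> *\<^sub>R v)"
  have e: "e \<mu> \<noteq> 0" "S *v e \<mu> = \<mu> *\<^sub>R e \<mu>" if "\<mu> \<in> eigenvalues S" for \<mu>
    using that someI_ex[of "\<lambda>v. v \<noteq> 0 \<and> S *v v = \<mu> *\<^sub>R v"]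
    unfolding e_def eigenvalues_def by auto
  have orth: "orthogonal (e a) (e b)"
    if "a \<in> eigenvalues S" "b \<in> eigenvalues S" "a \<noteq> b" for a b
  proof -
    have "b * (e a \<bullet> e b) = a * (e a \<bullet> e b)"
      using inner_symmetric_matrix[OF S, of "e a" "e b"] e that by simp
    then show ?thesis using that by (simp add: orthogonal_def)
  qed
  have "inj_on e (eigenvalues S)"
    by (rule inj_onI, rule ccontr) (metis orth e(1) orthogonal_self)
  moreover have "finite (e ` eigenvalues S)"
    by (rule pairwise_orthogonal_imp_finite) (auto simp: pairwise_def intro: orth)
  ultimately show ?thesis by (rule finite_imageD[rotated])
qed

text \<open>A minimiser of \<open>v \<bullet> S v\<close> on the unit sphere is an eigenvector, because the form
  \<open>v \<bullet> S v - m |v|\<^sup>2\<close> is then minimal at it.\<close>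

lemma minimal_Rayleigh_eigenvalue:
  fixes S :: "real^'n^'n"
  assumes S: "transpose S = S"
  obtains m where "m \<in> eigenvalues S" "\<And>v. m * (norm v)\<^sup>2 \<le> v \<bullet> (S *v v)"
proof -
  have "continuous_on (sphere 0 1) (\<lambda>v. v \<bullet> (S *v v))"
    by (intro continuous_intros)
  moreover have "(axis undefined 1 :: real^'n) \<in> sphere 0 1"
    by (simp add: norm_axis_1)
  ultimately obtain u :: "real^'n" where u: "norm u = 1"
    and umin: "\<And>v. norm v = 1 \<Longrightarrow> u \<bullet> (S *v u) \<le> v \<bullet> (S *v v)"
    using continuous_attains_inf[of "sphere 0 1" "\<lambda>v. v \<bullet> (S *v v)"]
    by (metis compact_sphere empty_iff mem_sphere_0)
  define m where "m = u \<bullet> (S *v u)"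
  have low: "m * (norm v)\<^sup>2 \<le> v \<bullet> (S *v v)" for v
  proof (cases "v = 0")
    case False
    have "m \<le> sgn v \<bullet> (S *v sgn v)" unfolding m_def using False by (intro umin) (simp add: norm_sgn)
    also have "\<dots> = (v \<bullet> (S *v v)) / (norm v)\<^sup>2"
      by (simp add: sgn_div_norm matrix_vector_mult_scaleR power2_eq_square field_simps)
    finally show ?thesis using False by (simp add: field_simps)
  qed simp
  define F where "F = (\<lambda>v. sq_norm S v - m * (v \<bullet> v))"
  have "GDERIV F u :> 2 *\<^sub>R (S *v u - m *\<^sub>R u)"
    unfolding F_def gderiv_def
    by (auto intro!: derivative_eq_intros S
        simp: fun_eq_iff inner_diff_right inner_commute algebra_simps)
  moreover have "F u \<le> F v" for v
    using low[of v] u by (simp add: F_def m_def sq_norm_def power2_norm_eq_inner[symmetric])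
  ultimately have "2 *\<^sub>R (S *v u - m *\<^sub>R u) = 0" by (rule gradient_eq_0_at_minimum)
  then have "S *v u = m *\<^sub>R u" by simp
  moreover have "u \<noteq> 0" using u by auto
  ultimately have "m \<in> eigenvalues S" by (auto simp: eigenvalues_def)
  then show thesis using low by (rule that)
qed

lemma lambda_min_le_quadratic_form:
  fixes S :: "real^'n^'n"
  assumes S: "transpose S = S"
  shows "lambda_min S * (norm v)\<^sup>2 \<le> v \<bullet> (S *v v)"
proof -
  obtain m where m: "m \<in> eigenvalues S" "\<And>v. m * (norm v)\<^sup>2 \<le> v \<bullet> (S *v v)"
    using minimal_Rayleigh_eigenvalue[OF S] by blast
  have "lambda_min S \<le> m"
    unfolding lambda_min_def using finite_eigenvalues[OF S] m(1) by (rule Min_le)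
  then show ?thesis using m(2)[of v] by (meson mult_right_mono order_trans zero_le_power2)
qed

text \<open>The Rayleigh argument applied to \<open>- S\<close>, whose eigenvalues are the negatives
  of those of \<open>S\<close>.\<close>

lemma quadratic_form_le_lambda_max:
  fixes S :: "real^'n^'n"
  assumes S: "transpose S = S"
  shows "v \<bullet> (S *v v) \<le> lambda_max S * (norm v)\<^sup>2"
proof -
  have neg: "(- S) *v u = - (S *v u)" for u
    by (metis add.right_inverse add_eq_0_iff matrix_vector_mult_0 matrix_vector_mult_add_rdistrib)
  have "transpose (- S) = - S"
    using S by (simp add: transpose_def vec_eq_iff)
  then obtain m where m: "m \<in> eigenvalues (- S)" "\<And>v. m * (norm v)\<^sup>2 \<le> v \<bullet> ((- S) *v v)"
    using minimal_Rayleigh_eigenvalue by blast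
  have "- m \<in> eigenvalues S"
    using m(1) unfolding eigenvalues_def neg by (auto, metis add.inverse_inverse scaleR_minus_left)
  then have "- m \<le> lambda_max S"
    unfolding lambda_max_def using finite_eigenvalues[OF S] by (intro Max_ge)
  then have "- m * (norm v)\<^sup>2 \<le> lambda_max S * (norm v)\<^sup>2" by (rule mult_right_mono) simp
  then show ?thesis using m(2)[of v] by (simp add: neg)
qed

lemma inner_transpose_mult_self:
  fixes A :: "real^'n^'m"
  shows "v \<bullet> ((transpose A ** A) *v v) = (norm (A *v v))\<^sup>2"
  by (simp add: matrix_vector_mul_assoc[symmetric] power2_norm_eq_inner)
     (metis dot_lmul_matrix transpose_matrix_vector inner_commute)

lemma symmetric_transpose_mult_self: "transpose (transpose A ** A) = transpose A ** (A :: real^'n^'m)"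
  by (simp add: matrix_transpose_mul)

lemma norm_matrix_vector_le: "norm (S *v v) \<le> spectral_norm S * norm (v :: real^'n)"
  by (rule onorm) (rule matrix_vector_mul_bounded_linear)

text \<open>Cauchy-Schwarz on \<open>v\<close> and \<open>(transpose A ** A) *v v\<close> produces
  exactly the constant that stands in the denominator of \<gamma>.\<close>

lemma norm_mult_le_spectral_norm:
  fixes A :: "real^'n^'m"
  shows "(norm (A *v v))\<^sup>2 \<le> spectral_norm (transpose A ** A) * (norm v)\<^sup>2"
proof -
  have "(norm (A *v v))\<^sup>2 \<le> norm v * norm ((transpose A ** A) *v v)"
    unfolding inner_transpose_mult_self[symmetric] by (rule norm_cauchy_schwarz)
  also have "\<dots> \<le> norm v * (spectral_norm (transpose A ** A) * norm v)"
    by (intro mult_left_mono norm_matrix_vector_le) simp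
  finally show ?thesis by (simp add: power2_eq_square algebra_simps)
qed

subsection \<open>Descent and line search\<close>

text \<open>The function \<open>\<phi>\<close> is \<open>f\<close> along the segment minus the
  claimed growth terms. Cauchy-Schwarz and the Lipschitz estimate between \<open>z\<close> and a
  later point of the segment make its derivative nonpositive.\<close>

lemma descent_lemma:
  fixes f :: "'a::real_inner \<Rightarrow> real"
  assumes df: "\<And>z. GDERIV f z :> df z"
    and seg: "\<And>t. t \<in> {0..1} \<Longrightarrow> z + t *\<^sub>R d \<in> S"
    and lip: "M-lipschitz_on S df" and t: "t \<in> {0..1}"
  shows "f (z + t *\<^sub>R d) \<le> f z + t * (df z \<bullet> d) + M / 2 * t\<^sup>2 * (norm d)\<^sup>2"
proof -
  define \<phi> where "\<phi> = (\<lambda>t. f (z + t *\<^sub>R d) - t * (df z \<bullet> d) - M / 2 * t\<^sup>2 * (norm d)\<^sup>2)"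
  have "\<phi> t \<le> \<phi> 0"
  proof (rule DERIV_nonpos_imp_nonincreasing[where f = \<phi>])
    fix u assume u: "0 \<le> u" "u \<le> t"
    have "((\<lambda>t. z + t *\<^sub>R d) has_derivative (\<lambda>h. h *\<^sub>R d)) (at u)"
      by (auto intro!: derivative_eq_intros)
    from has_derivative_compose[OF this, of f "\<lambda>h. h \<bullet> df (z + u *\<^sub>R d)"]
    have "((\<lambda>t. f (z + t *\<^sub>R d)) has_derivative (\<lambda>h. (h *\<^sub>R d) \<bullet> df (z + u *\<^sub>R d))) (at u)"
      using df[of "z + u *\<^sub>R d"] by (simp add: gderiv_def)
    then have "((\<lambda>t. f (z + t *\<^sub>R d)) has_real_derivative d \<bullet> df (z + u *\<^sub>R d)) (at u)"
      by (rule has_derivative_imp_has_field_derivative) simp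
    then have "(\<phi> has_real_derivative (d \<bullet> df (z + u *\<^sub>R d) - df z \<bullet> d - M * u * (norm d)\<^sup>2)) (at u)"
      unfolding \<phi>_def by (auto intro!: derivative_eq_intros)
    moreover have "d \<bullet> df (z + u *\<^sub>R d) - df z \<bullet> d - M * u * (norm d)\<^sup>2 \<le> 0"
    proof -
      have "d \<bullet> df (z + u *\<^sub>R d) - df z \<bullet> d = d \<bullet> (df (z + u *\<^sub>R d) - df z)"
        by (simp add: inner_diff_right inner_commute)
      also have "\<dots> \<le> norm d * norm (df (z + u *\<^sub>R d) - df z)" by (rule norm_cauchy_schwarz)
      also have "\<dots> \<le> norm d * (M * (u * norm d))"
        using lipschitz_onD[OF lip seg[of u] seg[of 0]] u t
        by (intro mult_left_mono) (auto simp: dist_norm)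
      finally show ?thesis by (simp add: power2_eq_square algebra_simps)
    qed
    ultimately show "\<exists>y. DERIV \<phi> u :> y \<and> y \<le> 0" by blast
  qed (use t in simp)
  then show ?thesis by (simp add: \<phi>_def)
qed

text \<open>Powers of \<nu> tend to 0 and trials of length at most \<tau> pass, so the
  \<open>LEAST\<close> has a genuine witness. Unless the first trial passes, the one before the
  accepted trial was rejected and hence longer than \<tau>, which bounds the accepted step below by
  \<open>\<nu> * \<tau>\<close>.\<close>

lemma armijo_step_bounds:
  assumes \<nu>: "0 < \<nu>" "\<nu> < 1" and \<tau>: "0 < \<tau>"
    and ok: "\<And>t. 0 < t \<Longrightarrow> t \<le> 1 \<Longrightarrow> t \<le> \<tau> \<Longrightarrow> F (z + t *\<^sub>R d) \<le> F z - \<rho> * t * sq_norm S d"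
  shows "armijo_step \<rho> \<nu> F S z d \<le> 1"
    and "\<nu> * min 1 \<tau> \<le> armijo_step \<rho> \<nu> F S z d"
    and "F (z + armijo_step \<rho> \<nu> F S z d *\<^sub>R d) \<le> F z - \<rho> * armijo_step \<rho> \<nu> F S z d * sq_norm S d"
proof -
  define P where "P = (\<lambda>i. F (z + \<nu> ^ i *\<^sub>R d) \<le> F z - \<rho> * \<nu> ^ i * sq_norm S d)"
  define i where "i = (LEAST i. P i)"
  have step: "armijo_step \<rho> \<nu> F S z d = \<nu> ^ i" by (simp add: armijo_step_def i_def P_def)
  have le1: "\<nu> ^ j \<le> 1" for j using \<nu> by (simp add: power_le_one)
  have P: "P j" if "\<nu> ^ j \<le> \<tau>" for j
    unfolding P_def using ok[of "\<nu> ^ j"] that \<nu> le1 by simp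
  obtain n where "\<nu> ^ n < \<tau>" using real_arch_pow_inv[OF \<tau> \<nu>(2)] by blast
  then have "P i" unfolding i_def using P by (metis LeastI less_imp_le)
  then show "F (z + armijo_step \<rho> \<nu> F S z d *\<^sub>R d)
      \<le> F z - \<rho> * armijo_step \<rho> \<nu> F S z d * sq_norm S d"
    unfolding step P_def .
  show "armijo_step \<rho> \<nu> F S z d \<le> 1" unfolding step by (rule le1)
  show "\<nu> * min 1 \<tau> \<le> armijo_step \<rho> \<nu> F S z d"
  proof (cases i)
    case 0
    have "\<nu> * min 1 \<tau> \<le> 1 * 1" using \<nu> \<tau> by (intro mult_mono) auto
    then show ?thesis unfolding step 0 by simp
  next
    case (Suc j)
    have "\<not> P j" using not_less_Least[of j P] Suc unfolding i_def by simp
    then have "\<tau> < \<nu> ^ j" using P by force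
    then show ?thesis unfolding step Suc using \<nu> by simp
  qed
qed

text \<open>In the applications \<open>c\<close> is \<open>1 / (1 + \<alpha>)\<close>. The gap
  \<open>c - \<rho>\<close> between the actual slope and the demanded one pays for the curvature
  term as long as the step is at most \<open>(c - \<rho>) * \<eta> / M\<close>; this is the origin
  of the fractions in \<gamma>.\<close>

lemma armijo_step_sufficient_decrease:
  assumes \<nu>: "0 < \<nu>" "\<nu> < 1" and \<rho>: "0 < \<rho>" "\<rho> < c" and pos: "0 < \<eta>" "0 < M"
    and S: "\<eta> * (norm d)\<^sup>2 \<le> sq_norm S d"
    and growth: "\<And>t. t \<in> {0..1} \<Longrightarrow>
      F (z + t *\<^sub>R d) \<le> F z - t * c * sq_norm S d + M / 2 * t\<^sup>2 * (norm d)\<^sup>2"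
    and \<gamma>: "0 \<le> \<gamma>" "\<gamma> \<le> \<nu> * min 1 ((c - \<rho>) * \<eta> / M)"
  shows "armijo_step \<rho> \<nu> F S z d \<in> {0..1}"
    and "F (z + armijo_step \<rho> \<nu> F S z d *\<^sub>R d) \<le> F z - \<rho> * \<gamma> * \<eta> * (norm d)\<^sup>2"
proof -
  let ?a = "armijo_step \<rho> \<nu> F S z d"
  have ok: "F (z + t *\<^sub>R d) \<le> F z - \<rho> * t * sq_norm S d"
    if t: "0 < t" "t \<le> 1" "t \<le> (c - \<rho>) * \<eta> / M" for t
  proof -
    have "M * t \<le> (c - \<rho>) * \<eta>" using t(3) pos by (simp add: field_simps)
    then have "M * t * (norm d)\<^sup>2 \<le> (c - \<rho>) * \<eta> * (norm d)\<^sup>2" by (rule mult_right_mono) simp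
    also have "\<dots> \<le> (c - \<rho>) * sq_norm S d" using S \<rho> by (simp add: mult.assoc mult_left_mono)
    finally have *: "M * t * (norm d)\<^sup>2 \<le> (c - \<rho>) * sq_norm S d" .
    \<comment> \<open>The growth bound carries only \<open>M / 2\<close>; nonnegativity lets the
      left side of \<open>*\<close> be halved.\<close>
    have "0 \<le> M * t * (norm d)\<^sup>2" using pos t by simp
    with * have "M / 2 * t * (norm d)\<^sup>2 \<le> (c - \<rho>) * sq_norm S d" by simp
    then have "t * (M / 2 * t * (norm d)\<^sup>2) \<le> t * ((c - \<rho>) * sq_norm S d)"
      using t by (intro mult_left_mono) auto
    then show ?thesis using growth[of t] t by (simp add: power2_eq_square algebra_simps)
  qed
  have "0 < (c - \<rho>) * \<eta> / M" using \<rho> pos by simp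
  note a = armijo_step_bounds[of \<nu> _ F z d \<rho> S, OF \<nu> this ok]
  have \<gamma>a: "\<gamma> \<le> ?a" using \<gamma>(2) a(2) by linarith
  then show "?a \<in> {0..1}" using a(1) \<gamma>(1) by simp
  have "\<gamma> * (\<eta> * (norm d)\<^sup>2) \<le> ?a * sq_norm S d"
    using \<gamma>a \<gamma>(1) S pos by (intro mult_mono) auto
  then have "\<rho> * (\<gamma> * (\<eta> * (norm d)\<^sup>2)) \<le> \<rho> * (?a * sq_norm S d)"
    using \<rho> by (intro mult_left_mono) auto
  then show "F (z + ?a *\<^sub>R d) \<le> F z - \<rho> * \<gamma> * \<eta> * (norm d)\<^sup>2" using a(3) by (simp add: mult.assoc)
qed

subsection \<open>Cluster points of bounded sequences\<close>

text \<open>Written as an intersection of closed sets, the set of cluster points is visibly closed,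
  and its boundedness can be read off the first closure.\<close>

lemma cluster_points_eq_Inter_closure:
  fixes X :: "nat \<Rightarrow> 'a::metric_space"
  shows "cluster_points X = (\<Inter>n. closure (X ` {n..}))"
proof (intro equalityI subsetI INT_I)
  fix p n assume "p \<in> cluster_points X"
  then obtain \<phi> where \<phi>: "strict_mono \<phi>" "(X \<circ> \<phi>) \<longlonglongrightarrow> p" by (auto simp: cluster_points_def)
  have "(\<lambda>k. (X \<circ> \<phi>) (k + n)) \<longlonglongrightarrow> p" using \<phi>(2) by (rule LIMSEQ_ignore_initial_segment)
  moreover have "(X \<circ> \<phi>) (k + n) \<in> X ` {n..}" for k
    using seq_suble[OF \<phi>(1), of "k + n"] by auto
  ultimately show "p \<in> closure (X ` {n..})"
    unfolding closure_sequential by (intro exI[of _ "\<lambda>k. (X \<circ> \<phi>) (k + n)"]) auto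
next
  fix p assume p: "p \<in> (\<Inter>n. closure (X ` {n..}))"
  have ex: "\<exists>m\<ge>n. dist (X m) p < e" if "e > 0" for n e
  proof -
    have "p \<in> closure (X ` {n..})" using p by blast
    then have "\<exists>q\<in>X ` {n..}. dist q p < e" using that unfolding closure_approachable by blast
    then show ?thesis by auto
  qed
  \<comment> \<open>Dependent choice, because each index must exceed the one chosen before
    it.\<close>
  have "\<exists>\<phi>. \<forall>n. dist (X (\<phi> n)) p < inverse (real (Suc n)) \<and> \<phi> n < \<phi> (Suc n)"
  proof (rule dependent_nat_choice)
    show "\<exists>m. dist (X m) p < inverse (real (Suc 0))" using ex[of _ 0] by force
    show "\<exists>m. dist (X m) p < inverse (real (Suc (Suc n))) \<and> k < m" for k n
      using ex[of "inverse (real (Suc (Suc n)))" "Suc k"] by (auto simp: Suc_le_eq)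
  qed
  then obtain \<phi> where \<phi>: "\<And>n. dist (X (\<phi> n)) p < inverse (real (Suc n))" "\<And>n. \<phi> n < \<phi> (Suc n)"
    by blast
  have "(X \<circ> \<phi>) \<longlonglongrightarrow> p"
    unfolding tendsto_dist_iff[of "X \<circ> \<phi>"]
    by (rule tendsto_sandwich[OF _ _ tendsto_const LIMSEQ_inverse_real_of_nat])
       (use \<phi>(1) in \<open>auto intro!: always_eventually less_imp_le\<close>)
  then show "p \<in> cluster_points X"
    using \<phi>(2) by (auto simp: cluster_points_def strict_mono_Suc_iff)
qed

lemma cluster_points_nonempty:
  fixes X :: "nat \<Rightarrow> 'a::heine_borel"
  assumes "bounded (range X)"
  shows "cluster_points X \<noteq> {}"
  using bounded_imp_convergent_subsequence[OF assms] by (auto simp: cluster_points_def)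

lemma compact_cluster_points:
  fixes X :: "nat \<Rightarrow> 'a::heine_borel"
  assumes "bounded (range X)"
  shows "compact (cluster_points X)"
proof -
  have "bounded (closure (X ` {0..}))"
    using assms by (intro bounded_closure) (auto simp: image_def elim: bounded_subset)
  moreover have "cluster_points X \<subseteq> closure (X ` {0..})"
    unfolding cluster_points_eq_Inter_closure by blast
  ultimately have "bounded (cluster_points X)" by (rule bounded_subset)
  moreover have "closed (cluster_points X)"
    unfolding cluster_points_eq_Inter_closure by blast
  ultimately show ?thesis by (simp add: compact_eq_bounded_closed)
qed

text \<open>Otherwise some subsequence stays at distance at least \<open>e\<close> from the cluster
  set; by boundedness it has a convergent subsequence, whose limit is itself a cluster
  point.\<close>

lemma infdist_cluster_points_tendsto_0:
  fixes X :: "nat \<Rightarrow> 'a::heine_borel"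
  assumes b: "bounded (range X)"
  shows "(\<lambda>k. infdist (X k) (cluster_points X)) \<longlonglongrightarrow> 0"
proof (rule ccontr)
  assume "\<not> ?thesis"
  then obtain e where e: "e > 0" "\<And>n. \<exists>k\<ge>n. infdist (X k) (cluster_points X) \<ge> e"
    unfolding lim_sequentially by (auto simp: dist_real_def infdist_nonneg not_less)
  then have "infinite {k. infdist (X k) (cluster_points X) \<ge> e}"
    by (auto simp: infinite_nat_iff_unbounded_le)
  then obtain \<psi> :: "nat \<Rightarrow> nat" where \<psi>: "strict_mono \<psi>"
    "\<And>n. infdist (X (\<psi> n)) (cluster_points X) \<ge> e"
    using infinite_enumerate by blast
  have "bounded (range (X \<circ> \<psi>))" using b by (rule bounded_subset) auto
  from bounded_imp_convergent_subsequence[OF this] obtain p \<phi>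
    where \<phi>: "strict_mono \<phi>" "((X \<circ> \<psi>) \<circ> \<phi>) \<longlonglongrightarrow> p" by blast
  then have p: "p \<in> cluster_points X"
    unfolding cluster_points_def using strict_mono_o[OF \<psi>(1) \<phi>(1)] by (auto simp: o_assoc)
  have "(\<lambda>n. infdist (((X \<circ> \<psi>) \<circ> \<phi>) n) (cluster_points X)) \<longlonglongrightarrow> infdist p (cluster_points X)"
    using \<phi>(2) by (rule tendsto_infdist)
  then have "e \<le> infdist p (cluster_points X)"
    by (rule LIMSEQ_le_const) (use \<psi>(2) in auto)
  then show False using p e(1) by simp
qed

text \<open>Every subsequence of \<open>Y\<close> inherits the limit \<open>c\<close>. Applied to
  the iterates and the previous directions, this gives the product form of
  \<open>\<Omega>h\<close>.\<close>

lemma cluster_points_Pair_convergent: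
  fixes X :: "nat \<Rightarrow> 'a::topological_space" and Y :: "nat \<Rightarrow> 'b::t2_space"
  assumes Y: "Y \<longlonglongrightarrow> c"
  shows "cluster_points (\<lambda>k. (X k, Y k)) = cluster_points X \<times> {c}"
proof (intro equalityI subsetI)
  fix p assume "p \<in> cluster_points (\<lambda>k. (X k, Y k))"
  then obtain \<phi> where \<phi>: "strict_mono \<phi>" "((\<lambda>k. (X k, Y k)) \<circ> \<phi>) \<longlonglongrightarrow> p"
    by (auto simp: cluster_points_def)
  have "(X \<circ> \<phi>) \<longlonglongrightarrow> fst p" using tendsto_fst[OF \<phi>(2)] by (simp add: o_def)
  moreover have "(Y \<circ> \<phi>) \<longlonglongrightarrow> snd p" using tendsto_snd[OF \<phi>(2)] by (simp add: o_def)
  moreover have "(Y \<circ> \<phi>) \<longlonglongrightarrow> c" using Y \<phi>(1) by (rule LIMSEQ_subseq_LIMSEQ)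
  ultimately show "p \<in> cluster_points X \<times> {c}"
    using \<phi>(1) LIMSEQ_unique by (auto simp: cluster_points_def mem_Times_iff)
next
  fix p assume "p \<in> cluster_points X \<times> {c}"
  then obtain q \<phi> where p: "p = (q, c)" and \<phi>: "strict_mono \<phi>" "(X \<circ> \<phi>) \<longlonglongrightarrow> q"
    by (auto simp: cluster_points_def)
  have "(\<lambda>k. ((X \<circ> \<phi>) k, (Y \<circ> \<phi>) k)) \<longlonglongrightarrow> (q, c)"
    by (intro tendsto_Pair \<phi>(2) LIMSEQ_subseq_LIMSEQ[OF Y \<phi>(1)])
  then show "p \<in> cluster_points (\<lambda>k. (X k, Y k))"
    using \<phi>(1) by (auto simp: cluster_points_def p o_def)
qed

subsection \<open>The augmented Lagrangian and its quadratic models\<close>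

lemma inner_vector_matrix:
  fixes A :: "real^'n^'m"
  shows "h \<bullet> (u v* A) = u \<bullet> (A *v h)"
  by (metis dot_lmul_matrix inner_commute)

lemma cal_Hx_mult:
  "cal_Hx A \<beta> ell H *v v = H *v v + \<beta> *\<^sub>R (transpose A *v (A *v v)) + ell *\<^sub>R v"
  by (simp add: cal_Hx_def matrix_vector_mult_add_rdistrib scaleR_matrix_vector_assoc[symmetric]
      matrix_vector_mul_assoc[symmetric])

lemma cal_Hy_mult: "cal_Hy \<beta> \<sigma> H *v v = H *v v + (\<beta> + \<sigma>) *\<^sub>R v"
  by (simp add: cal_Hy_def matrix_vector_mult_add_rdistrib scaleR_matrix_vector_assoc[symmetric])

lemmas matrix_vector_has_derivative [derivative_intros] =
  bounded_linear.has_derivative[OF matrix_vector_mul_bounded_linear]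

text \<open>\<open>cal_Hx\<close> is the Hessian of the model. Moving the stationarity condition
  from the minimiser \<open>x1\<close> back to \<open>x0\<close> leaves on the left the partial
  gradient of the augmented Lagrangian at the current iterate, which is the form the slope
  computation needs.\<close>

lemma x_model_minimizer:
  fixes A :: "real^'n^'m"
  assumes H: "transpose H = H"
    and min: "is_arg_min (x_model A \<beta> ell c H x0 y0 l) (\<lambda>_. True) x1"
  shows "c - transpose A *v l + \<beta> *\<^sub>R (transpose A *v (A *v x0 - y0))
    = - (cal_Hx A \<beta> ell H *v (x1 - x0))"
proof -
  have "GDERIV (x_model A \<beta> ell c H x0 y0 l) x1 :>
     c + H *v (x1 - x0) - transpose A *v l + \<beta> *\<^sub>R (transpose A *v (A *v x1 - y0)) + ell *\<^sub>R (x1 - x0)"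
    unfolding x_model_def[abs_def] gderiv_def power2_norm_eq_inner
    by (rule has_derivative_eq_rhs, (rule derivative_intros H)+)
       (simp add: fun_eq_iff inner_add_right inner_diff_right inner_vector_matrix,
        simp add: inner_commute inner_diff_left inner_diff_right field_simps)
  moreover have "x_model A \<beta> ell c H x0 y0 l x1 \<le> x_model A \<beta> ell c H x0 y0 l v" for v
    using min by (auto simp: is_arg_min_linorder)
  ultimately have "c + H *v (x1 - x0) - transpose A *v l
     + \<beta> *\<^sub>R (transpose A *v (A *v x1 - y0)) + ell *\<^sub>R (x1 - x0) = 0"
    by (rule gradient_eq_0_at_minimum)
  moreover have "transpose A *v (A *v x1 - y0)
      = transpose A *v (A *v (x1 - x0)) + transpose A *v (A *v x0 - y0)"
    by (simp add: matrix_vector_mult_diff_distrib)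
  ultimately show ?thesis
    by (simp add: cal_Hx_mult add_eq_0_iff algebra_simps)
qed

lemma y_model_minimizer:
  fixes A :: "real^'n^'m"
  assumes H: "transpose H = H"
    and min: "is_arg_min (y_model A \<beta> \<sigma> c H x1 y0 l) (\<lambda>_. True) y1"
  shows "c + l - \<beta> *\<^sub>R (A *v x1 - y0) = - (cal_Hy \<beta> \<sigma> H *v (y1 - y0))"
proof -
  have "GDERIV (y_model A \<beta> \<sigma> c H x1 y0 l) y1 :>
     c + H *v (y1 - y0) + l - \<beta> *\<^sub>R (A *v x1 - y1) + \<sigma> *\<^sub>R (y1 - y0)"
    unfolding y_model_def[abs_def] gderiv_def power2_norm_eq_inner
    by (rule has_derivative_eq_rhs, (rule derivative_intros H)+)
       (simp add: fun_eq_iff inner_add_right inner_diff_right,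
        simp add: inner_commute inner_diff_left inner_diff_right field_simps)
  moreover have "y_model A \<beta> \<sigma> c H x1 y0 l y1 \<le> y_model A \<beta> \<sigma> c H x1 y0 l v" for v
    using min by (auto simp: is_arg_min_linorder)
  ultimately have "c + H *v (y1 - y0) + l - \<beta> *\<^sub>R (A *v x1 - y1) + \<sigma> *\<^sub>R (y1 - y0) = 0"
    by (rule gradient_eq_0_at_minimum)
  then show ?thesis
    by (simp add: cal_Hy_mult add_eq_0_iff algebra_simps)
qed

lemma GDERIV_aug_lagrangian:
  fixes A :: "real^'n^'m"
  assumes f: "GDERIV f x :> gx" and g: "GDERIV g y :> gy"
  shows "GDERIV (aug_lagrangian f g A \<beta>) (x, y, l) :>
    (gx - transpose A *v l + \<beta> *\<^sub>R (transpose A *v (A *v x - y)),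
     gy + l - \<beta> *\<^sub>R (A *v x - y), - (A *v x - y))"
proof -
  have [derivative_intros]:
    "((\<lambda>w. f (fst w)) has_derivative (\<lambda>h. fst h \<bullet> gx)) (at (x, y, l))"
    "((\<lambda>w. g (fst (snd w))) has_derivative (\<lambda>h. fst (snd h) \<bullet> gy)) (at (x, y, l))"
    using f g unfolding gderiv_def
    by (auto intro!: has_derivative_compose[of fst fst _ _ f] has_derivative_compose[of "\<lambda>w. fst (snd w)" "\<lambda>w. fst (snd w)" _ _ g]
        derivative_intros)
  show ?thesis
    unfolding gderiv_def aug_lagrangian_def case_prod_unfold power2_norm_eq_inner
    by (rule has_derivative_eq_rhs, (rule derivative_intros)+)
       (simp add: fun_eq_iff inner_add_right inner_diff_right inner_vector_matrix,
        simp add: inner_commute inner_diff_left inner_diff_right field_simps)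
qed

text \<open>The multiplier and penalty terms are polynomial of degree at most two in
  \<open>x\<close> and are expanded exactly; the descent lemma is applied to \<open>f\<close> alone.
  The penalty contributes the \<open>\<beta> * spectral_norm (transpose A ** A)\<close> part of the
  curvature.\<close>

lemma aug_lagrangian_x_descent:
  fixes A :: "real^'n^'m"
  assumes f: "\<And>z. GDERIV f z :> gradf z"
    and seg: "\<And>t. t \<in> {0..1} \<Longrightarrow> x + t *\<^sub>R d \<in> S"
    and lip: "M-lipschitz_on S gradf" and t: "t \<in> {0..1}" and \<beta>: "0 \<le> \<beta>"
  shows "aug_lagrangian f g A \<beta> (x + t *\<^sub>R d, y, l) \<le> aug_lagrangian f g A \<beta> (x, y, l)
     + t * (d \<bullet> (gradf x - transpose A *v l + \<beta> *\<^sub>R (transpose A *v (A *v x - y))))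
     + (M + \<beta> * spectral_norm (transpose A ** A)) / 2 * t\<^sup>2 * (norm d)\<^sup>2"
proof -
  have "aug_lagrangian f g A \<beta> (x + t *\<^sub>R d, y, l) = aug_lagrangian f g A \<beta> (x, y, l)
     + (f (x + t *\<^sub>R d) - f x)
     + t * (d \<bullet> (\<beta> *\<^sub>R (transpose A *v (A *v x - y)) - transpose A *v l))
     + \<beta> / 2 * t\<^sup>2 * (norm (A *v d))\<^sup>2"
    unfolding aug_lagrangian_def power2_norm_eq_inner
    by (simp add: inner_add_right inner_diff_right inner_diff_left inner_add_left
          inner_vector_matrix matrix_vector_right_distrib matrix_vector_mult_scaleR,
        simp add: inner_commute field_simps power2_eq_square)
  moreover have "f (x + t *\<^sub>R d) - f x \<le> t * (d \<bullet> gradf x) + M / 2 * t\<^sup>2 * (norm d)\<^sup>2"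
    using descent_lemma[of f gradf, OF f seg lip t] by (simp add: inner_commute)
  moreover have "\<beta> / 2 * t\<^sup>2 * (norm (A *v d))\<^sup>2
      \<le> \<beta> / 2 * t\<^sup>2 * (spectral_norm (transpose A ** A) * (norm d)\<^sup>2)"
    using \<beta> by (intro mult_left_mono norm_mult_le_spectral_norm) auto
  ultimately show ?thesis by (simp add: inner_add_right inner_diff_right field_simps)
qed

lemma aug_lagrangian_y_descent:
  fixes A :: "real^'n^'m"
  assumes g: "\<And>z. GDERIV g z :> gradg z"
    and seg: "\<And>t. t \<in> {0..1} \<Longrightarrow> y + t *\<^sub>R d \<in> S"
    and lip: "M-lipschitz_on S gradg" and t: "t \<in> {0..1}"
  shows "aug_lagrangian f g A \<beta> (x, y + t *\<^sub>R d, l) \<le> aug_lagrangian f g A \<beta> (x, y, l)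
     + t * (d \<bullet> (gradg y + l - \<beta> *\<^sub>R (A *v x - y)))
     + (M + \<beta>) / 2 * t\<^sup>2 * (norm d)\<^sup>2"
proof -
  have "aug_lagrangian f g A \<beta> (x, y + t *\<^sub>R d, l) = aug_lagrangian f g A \<beta> (x, y, l)
     + (g (y + t *\<^sub>R d) - g y) + t * (d \<bullet> (l - \<beta> *\<^sub>R (A *v x - y))) + \<beta> / 2 * t\<^sup>2 * (norm d)\<^sup>2"
    unfolding aug_lagrangian_def power2_norm_eq_inner
    by (simp add: inner_add_right inner_diff_right inner_diff_left inner_add_left,
        simp add: inner_commute field_simps power2_eq_square)
  moreover have "g (y + t *\<^sub>R d) - g y \<le> t * (d \<bullet> gradg y) + M / 2 * t\<^sup>2 * (norm d)\<^sup>2"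
    using descent_lemma[of g gradg, OF g seg lip t] by (simp add: inner_commute)
  ultimately show ?thesis by (simp add: inner_add_right inner_diff_right field_simps)
qed

text \<open>This identity isolates two controllable quantities: with residuals for \<open>u\<close>
  and \<open>v\<close>, the weighted sum is a multiple of the multiplier increment and
  \<open>u - v\<close> is the displacement of \<open>y\<close>.\<close>

lemma weighted_sum_norm_squares:
  fixes u v :: "'a::real_inner"
  assumes "r + s \<noteq> 0"
  shows "r * (norm u)\<^sup>2 + s * (norm v)\<^sup>2
    = (norm (r *\<^sub>R u + s *\<^sub>R v))\<^sup>2 / (r + s) + r * s / (r + s) * (norm (u - v))\<^sup>2"
proof -
  have "(r + s) * (r * (norm u)\<^sup>2 + s * (norm v)\<^sup>2)
    = (norm (r *\<^sub>R u + s *\<^sub>R v))\<^sup>2 + r * s * (norm (u - v))\<^sup>2"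
    by (simp add: power2_norm_eq_inner inner_add_left inner_add_right inner_diff_left
        inner_diff_right inner_commute algebra_simps)
  then have "r * (norm u)\<^sup>2 + s * (norm v)\<^sup>2
    = ((norm (r *\<^sub>R u + s *\<^sub>R v))\<^sup>2 + r * s * (norm (u - v))\<^sup>2) / (r + s)"
    using assms by (metis nonzero_mult_div_cancel_left)
  then show ?thesis by (simp add: add_divide_distrib)
qed

lemma norm_sum_squared_le:
  fixes v :: "'b \<Rightarrow> 'a::real_inner"
  shows "(norm (\<Sum>i\<in>I. v i))\<^sup>2 \<le> real (card I) * (\<Sum>i\<in>I. (norm (v i))\<^sup>2)"
proof -
  have "(norm (\<Sum>i\<in>I. v i))\<^sup>2 \<le> (\<Sum>i\<in>I. norm (v i))\<^sup>2"
    by (intro power_mono norm_sum) simp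
  also have "\<dots> \<le> real (card I) * (\<Sum>i\<in>I. (norm (v i))\<^sup>2)"
    using sum_squared_le_sum_of_squares[of "\<lambda>i. norm (v i)" I] by (simp add: mult.commute)
  finally show ?thesis .
qed

text \<open>Source of the factor 6 in the merit function, \<open>\<delta>x\<close> and
  \<open>\<delta>y\<close>: the multiplier increment is split into six vectors.\<close>

lemma norm_sum_six_squared_le:
  fixes a b c d e f :: "'a::real_inner"
  shows "(norm (a + b + c + d + e + f))\<^sup>2
    \<le> 6 * ((norm a)\<^sup>2 + (norm b)\<^sup>2 + (norm c)\<^sup>2 + (norm d)\<^sup>2 + (norm e)\<^sup>2 + (norm f)\<^sup>2)"
  using norm_sum_squared_le[of "\<lambda>i. [a, b, c, d, e, f] ! i" "{..<6}"]
  by (simp add: eval_nat_numeral algebra_simps)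

text \<open>Telescoping bounds the partial sums of \<open>a\<close> by \<open>V 0\<close> minus the
  infimum of \<open>V\<close>.\<close>

lemma sufficient_decrease:
  fixes V a :: "nat \<Rightarrow> real"
  assumes dec: "\<And>k. V (Suc k) \<le> V k - a k" and a: "\<And>k. 0 \<le> a k" and b: "bdd_below (range V)"
  shows "V \<longlonglongrightarrow> (INF k. V k)" and "summable a"
proof -
  have "V (Suc k) \<le> V k" for k using dec[of k] a[of k] by linarith
  then show "V \<longlonglongrightarrow> (INF k. V k)" using b by (intro LIMSEQ_decseq_INF decseq_SucI)
  show "summable a"
  proof (rule bounded_imp_summable)
    have "(\<Sum>k\<le>n. a k) \<le> V 0 - V (Suc n)" for n
    proof (induction n)
      case 0
      show ?case using dec[of 0] by simp
    next
      case (Suc n)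
      then show ?case using dec[of "Suc n"] by simp
    qed
    moreover have "(INF k. V k) \<le> V n" for n using b by (rule cINF_lower) simp
    ultimately show "(\<Sum>k\<le>n. a k) \<le> V 0 - (INF k. V k)" for n
      by (meson diff_left_mono order_trans)
  qed (rule a)
qed

lemma multiplier_updates_increase:
  fixes A :: "real^'n^'m" and y0 y1 l0 lh l1 :: "real^'m"
  assumes lh: "lh = l0 - (r * \<beta>) *\<^sub>R (A *v x - y0)"
    and l1: "l1 = lh - (s * \<beta>) *\<^sub>R (A *v x - y1)"
    and "0 < \<beta>" "r + s \<noteq> 0"
  shows "aug_lagrangian f g A \<beta> (x, y1, l1) - aug_lagrangian f g A \<beta> (x, y1, lh)
      + (aug_lagrangian f g A \<beta> (x, y0, lh) - aug_lagrangian f g A \<beta> (x, y0, l0))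
    \<le> (norm (l1 - l0))\<^sup>2 / (\<bar>r + s\<bar> * \<beta>) + \<bar>r * s\<bar> * \<beta> / \<bar>r + s\<bar> * (norm (y1 - y0))\<^sup>2"
    (is "?lhs \<le> _")
proof -
  define u v where "u = A *v x - y0" and "v = A *v x - y1"
  have dl: "l1 - l0 = - (\<beta> *\<^sub>R (r *\<^sub>R u + s *\<^sub>R v))"
    unfolding l1 lh u_def v_def by (simp add: algebra_simps)
  have dy: "y1 - y0 = u - v" by (simp add: u_def v_def)
  have "?lhs = \<beta> * (r * (norm u)\<^sup>2 + s * (norm v)\<^sup>2)"
    unfolding aug_lagrangian_def prod.case l1 lh u_def[symmetric] v_def[symmetric]
    by (simp add: inner_diff_left power2_norm_eq_inner algebra_simps)
  also have "\<dots> = \<beta> * ((norm (r *\<^sub>R u + s *\<^sub>R v))\<^sup>2 / (r + s)) + r * s / (r + s) * \<beta> * (norm (u - v))\<^sup>2"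
    unfolding weighted_sum_norm_squares[OF assms(4)] by (simp add: algebra_simps)
  \<comment> \<open>The signs of \<open>r + s\<close> and \<open>r * s\<close> are arbitrary, hence
    the absolute values.\<close>
  also have "\<dots> \<le> \<beta> * ((norm (r *\<^sub>R u + s *\<^sub>R v))\<^sup>2 / \<bar>r + s\<bar>)
      + \<bar>r * s / (r + s)\<bar> * \<beta> * (norm (u - v))\<^sup>2"
    using assms(3)
    by (intro add_mono mult_left_mono mult_right_mono abs_ge_self)
       (auto simp: abs_if divide_nonneg_neg divide_nonpos_neg divide_le_0_iff intro: order_trans[of _ 0])
  also have "\<beta> * ((norm (r *\<^sub>R u + s *\<^sub>R v))\<^sup>2 / \<bar>r + s\<bar>) = (norm (l1 - l0))\<^sup>2 / (\<bar>r + s\<bar> * \<beta>)"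
    using assms(3) unfolding dl by (simp add: power_mult_distrib power2_eq_square)
  finally show ?thesis unfolding dy by (simp add: abs_mult abs_divide)
qed

subsection \<open>Convergence of the algorithm\<close>

text \<open>Two infima occur because descent from index 0 to index 1 depends on how the starting
  multiplier relates to a preceding \<open>y\<close>-step. From index 1 on that step is a real one,
  so the infimum over \<open>{1..}\<close> is unconditional, while the one over all indices is tied
  to \<open>y_step_at_minus_one\<close>.\<close>

theorem theorem1:
  fixes f :: "real^'n \<Rightarrow> real" and gradf :: "real^'n \<Rightarrow> real^'n"
    and g :: "real^'m \<Rightarrow> real" and gradg :: "real^'m \<Rightarrow> real^'m"
    and A :: "real^'n^'m"
    and \<rho> \<nu> \<alpha> \<beta> ell \<sigma> r s :: real
    and Hx :: "nat \<Rightarrow> real^'n^'n" and Hy :: "nat \<Rightarrow> real^'m^'m"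
    and x xt xb dx :: "nat \<Rightarrow> real^'n" and y yt yb dy lam lamh :: "nat \<Rightarrow> real^'m"
    and tx ty :: "nat \<Rightarrow> real"
    and w :: "nat \<Rightarrow> (real^'n) \<times> (real^'m) \<times> (real^'m)"
    and wh :: "nat \<Rightarrow> ((real^'n) \<times> (real^'m) \<times> (real^'m)) \<times> (real^'m)"
    and \<eta>x \<eta>y llx lly \<eta>1x \<eta>1y \<eta>2y Lf Lg \<gamma> \<delta>x \<delta>y :: real
    and Sx :: "(real^'n) set" and Sy :: "(real^'m) set"
    and L :: "(real^'n) \<times> (real^'m) \<times> (real^'m) \<Rightarrow> real"
    and Lh :: "((real^'n) \<times> (real^'m) \<times> (real^'m)) \<times> (real^'m) \<Rightarrow> real"
    and \<Omega> :: "((real^'n) \<times> (real^'m) \<times> (real^'m)) set"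
    and \<Omega>h :: "(((real^'n) \<times> (real^'m) \<times> (real^'m)) \<times> (real^'m)) set"
  assumes f_C1: "\<And>z. GDERIV f z :> gradf z" "continuous_on UNIV gradf"
    and g_C1: "\<And>z. GDERIV g z :> gradg z" "continuous_on UNIV gradg"
    and L_eq: "L = aug_lagrangian f g A \<beta>"
    (* parameters *)
    and params: "0 < \<rho>" "\<rho> < 1" "0 < \<nu>" "\<nu> < 1" "-1 < \<alpha>" "\<alpha> < 1 / \<rho> - 1"
      "0 < \<beta>" "0 < ell" "0 < \<sigma>" "r + s \<noteq> 0"
    and H_sym: "\<And>k. transpose (Hx k) = Hx k" "\<And>k. transpose (Hy k) = Hy k"
    and H0_pd: "pos_def (Hx 0)" "pos_def (Hy 0)"
    and cal_H_pd: "\<And>k. pos_def (cal_Hx A \<beta> ell (Hx k))" "\<And>k. pos_def (cal_Hy \<beta> \<sigma> (Hy k))"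
    (* step (1) *)
    and xt: "\<And>k. is_arg_min (x_model A \<beta> ell (gradf (x k)) (Hx k) (x k) (y k) (lam k))
                    (\<lambda>_. True) (xt (Suc k))"
    and xb: "\<And>k. xb (Suc k) = xt (Suc k) + \<alpha> *\<^sub>R (xt (Suc k) - x k)"
    and dx: "\<And>k. dx k = xb (Suc k) - x k"
    and tx: "\<And>k. tx k = armijo_step \<rho> \<nu> (\<lambda>z. L (z, y k, lam k))
                    (cal_Hx A \<beta> ell (Hx k)) (x k) (dx k)"
    and x_Suc: "\<And>k. x (Suc k) = x k + tx k *\<^sub>R dx k"
    (* step (2); lamh k is the multiplier of index k + 1/2 *)
    and lamh: "\<And>k. lamh k = lam k - (r * \<beta>) *\<^sub>R (A *v x (Suc k) - y k)"
    (* step (3) *)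
    and yt: "\<And>k. is_arg_min (y_model A \<beta> \<sigma> (gradg (y k)) (Hy k) (x (Suc k)) (y k) (lamh k))
                    (\<lambda>_. True) (yt (Suc k))"
    and yb: "\<And>k. yb (Suc k) = yt (Suc k) + \<alpha> *\<^sub>R (yt (Suc k) - y k)"
    and dy: "\<And>k. dy k = yb (Suc k) - y k"
    and ty: "\<And>k. ty k = armijo_step \<rho> \<nu> (\<lambda>z. L (x (Suc k), z, lamh k))
                    (cal_Hy \<beta> \<sigma> (Hy k)) (y k) (dy k)"
    and y_Suc: "\<And>k. y (Suc k) = y k + ty k *\<^sub>R dy k"
    (* step (4) *)
    and lam_Suc: "\<And>k. lam (Suc k) = lamh k - (s * \<beta>) *\<^sub>R (A *v x (Suc k) - y (Suc k))"
    and w: "\<And>k. w k = (x k, y k, lam k)"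
    (* the direction of index -1 is 0 *)
    and wh: "\<And>k. wh k = (w k, case k of 0 \<Rightarrow> 0 | Suc j \<Rightarrow> dy j)"
    (* standing assumptions *)
    and w_bounded: "bounded (range w)"
    and H_bound: "\<And>k. spectral_norm (Hx k) \<le> \<eta>x" "\<And>k. spectral_norm (Hy k) \<le> \<eta>y"
    and H_lower: "\<And>k. llx \<le> lambda_min (Hx k)" "\<And>k. lly \<le> lambda_min (Hy k)"
    and \<eta>1x: "\<eta>1x = llx + \<beta> * lambda_min (transpose A ** A) + ell" "0 < \<eta>1x"
    and \<eta>1y: "\<eta>1y = lly + \<beta> + \<sigma>" "0 < \<eta>1y"
    and grad_lip: "locally_lipschitz gradf" "locally_lipschitz gradg"
    (* constants *)
    and \<eta>2y: "\<eta>2y = \<eta>y + \<beta> + \<sigma>"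
    and Sx: "compact Sx" "\<And>k t. t \<in> {0..1} \<Longrightarrow> x k + t *\<^sub>R dx k \<in> Sx"
    and Sy: "compact Sy" "\<And>k t. t \<in> {0..1} \<Longrightarrow> y k + t *\<^sub>R dy k \<in> Sy"
    and Lf: "0 < Lf" "Lf-lipschitz_on Sx gradf"
    and Lg: "0 < Lg" "Lg-lipschitz_on Sy gradg"
    and \<gamma>: "\<gamma> = \<nu> * Min {1,
               (1 / (1 + \<alpha>) - \<rho>) * \<eta>1x / (Lf + \<beta> * spectral_norm (transpose A ** A)),
               (1 / (1 + \<alpha>) - \<rho>) * \<eta>1y / (Lg + \<beta>)}"
    and \<delta>y: "\<delta>y = \<rho> * \<gamma> * \<eta>1y
               - 6 / (\<bar>r + s\<bar> * \<beta>) * (Lg\<^sup>2 + (1 + s\<^sup>2) * \<beta>\<^sup>2 + 2 * (\<eta>2y / (1 + \<alpha>))\<^sup>2)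
               - \<bar>r * s\<bar> * \<beta> / \<bar>r + s\<bar>"
    and \<delta>x: "\<delta>x = \<rho> * \<gamma> * \<eta>1x
               - 6 * (1 - s)\<^sup>2 * \<beta> * lambda_max (transpose A ** A) / \<bar>r + s\<bar>"
    (* parameter choice *)
    and \<delta>_pos: "0 < \<delta>x" "0 < \<delta>y"
    and Lh_eq: "Lh = merit L \<beta> \<alpha> r s Lg \<eta>2y"
    and \<Omega>: "\<Omega> = cluster_points w"
    and \<Omega>h: "\<Omega>h = cluster_points wh"
  shows
    "(convergent (\<lambda>k. Lh (wh k)) \<and> bdd_below (range (\<lambda>k. Lh (wh k))) \<and>
      (\<forall>p\<in>\<Omega>h. Lh p = lim (\<lambda>k. Lh (wh k))) \<and>
      lim (\<lambda>k. Lh (wh k)) = (INF k\<in>{1..}. Lh (wh k)) \<and>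
      (y_step_at_minus_one A \<beta> \<sigma> s (gradg (y 0)) (Hy 0) (x 0) (y 0) (lam 0) \<longrightarrow>
         lim (\<lambda>k. Lh (wh k)) = (INF k. Lh (wh k))) \<and>
      Lh constant_on \<Omega>h) \<and>
     ((\<lambda>k. norm (dx k)) \<longlonglongrightarrow> 0 \<and> (\<lambda>k. norm (dy k)) \<longlonglongrightarrow> 0 \<and>
      summable (\<lambda>k. (norm (w (Suc k) - w k))\<^sup>2)) \<and>
     (\<Omega> \<noteq> {} \<and> compact \<Omega> \<and> \<Omega>h \<noteq> {} \<and> compact \<Omega>h \<and>
      (\<lambda>k. infdist (w k) \<Omega>) \<longlonglongrightarrow> 0 \<and> (\<lambda>k. infdist (wh k) \<Omega>h) \<longlonglongrightarrow> 0) \<and>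
     \<Omega> \<subseteq> crit L \<and>
     (\<Omega>h = {((xs, ys, ls), 0) | xs ys ls. (xs, ys, ls) \<in> \<Omega>} \<and> \<Omega>h = \<Omega> \<times> {0})"
proof -

  \<comment> \<open>Constants and lower bounds of the quadratic forms\<close>
  let ?c = "1 / (1 + \<alpha>)"
  let ?AA = "transpose A ** A"
  define E where "E = \<eta>2y / (1 + \<alpha>)"
  \<comment> \<open>The upper bound on \<alpha> says precisely that the slope factor
    \<open>?c\<close> exceeds \<rho>.\<close>
  have c: "0 < ?c" "\<rho> < ?c" using params by (auto simp: field_simps)
  have AA: "transpose ?AA = ?AA" by (rule symmetric_transpose_mult_self)
  have quad_x: "\<eta>1x * (norm v)\<^sup>2 \<le> sq_norm (cal_Hx A \<beta> ell (Hx k)) v" for k v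
  proof -
    have "llx * (norm v)\<^sup>2 \<le> v \<bullet> (Hx k *v v)"
      using lambda_min_le_quadratic_form[OF H_sym(1), of k v] H_lower(1)[of k]
      by (meson mult_right_mono order_trans zero_le_power2)
    moreover have "\<beta> * (lambda_min ?AA * (norm v)\<^sup>2) \<le> \<beta> * (v \<bullet> (?AA *v v))"
      using params(7) by (intro mult_left_mono lambda_min_le_quadratic_form[OF AA]) simp
    ultimately show ?thesis
      unfolding sq_norm_def cal_Hx_mult \<eta>1x(1) matrix_vector_mul_assoc
      by (simp add: inner_add_right power2_norm_eq_inner algebra_simps)
  qed
  have quad_y: "\<eta>1y * (norm v)\<^sup>2 \<le> sq_norm (cal_Hy \<beta> \<sigma> (Hy k)) v" for k v
  proof -
    have "lly * (norm v)\<^sup>2 \<le> v \<bullet> (Hy k *v v)"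
      using lambda_min_le_quadratic_form[OF H_sym(2), of k v] H_lower(2)[of k]
      by (meson mult_right_mono order_trans zero_le_power2)
    then show ?thesis
      unfolding sq_norm_def cal_Hy_mult \<eta>1y(1)
      by (simp add: inner_add_right power2_norm_eq_inner algebra_simps)
  qed
  have "0 \<le> spectral_norm ?AA" by (rule onorm_pos_le) (rule matrix_vector_mul_bounded_linear)
  then have Mx: "0 < Lf + \<beta> * spectral_norm ?AA" using Lf(1) params(7) by (intro add_pos_nonneg) auto
  have My: "0 < Lg + \<beta>" using Lg(1) params(7) by simp
  have \<gamma>0: "0 \<le> \<gamma>"
    unfolding \<gamma> using params c \<eta>1x(2) \<eta>1y(2) Mx My by (intro mult_nonneg_nonneg) auto
  have \<gamma>x: "\<gamma> \<le> \<nu> * min 1 ((?c - \<rho>) * \<eta>1x / (Lf + \<beta> * spectral_norm ?AA))"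
    and \<gamma>y: "\<gamma> \<le> \<nu> * min 1 ((?c - \<rho>) * \<eta>1y / (Lg + \<beta>))"
    unfolding \<gamma> using params(3) by (auto intro!: mult_left_mono)

  \<comment> \<open>First-order optimality of the two subproblems\<close>
  have optx: "gradf (x k) - transpose A *v lam k + \<beta> *\<^sub>R (transpose A *v (A *v x k - y k))
      = - (?c *\<^sub>R (cal_Hx A \<beta> ell (Hx k) *v dx k))" for k
  proof -
    \<comment> \<open>Relaxation stretches the subproblem step by \<open>1 + \<alpha>\<close>, so
      optimality in terms of \<open>dx k\<close> acquires the factor \<open>?c\<close>.\<close>
    have "dx k = (1 + \<alpha>) *\<^sub>R (xt (Suc k) - x k)" by (simp add: dx xb algebra_simps)
    then have "xt (Suc k) - x k = ?c *\<^sub>R dx k" using c by simp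
    then show ?thesis
      using x_model_minimizer[OF H_sym(1) xt, of k] by (simp only: matrix_vector_mult_scaleR)
  qed
  have opty: "gradg (y k) + lamh k - \<beta> *\<^sub>R (A *v x (Suc k) - y k)
      = - (?c *\<^sub>R (cal_Hy \<beta> \<sigma> (Hy k) *v dy k))" for k
  proof -
    have "dy k = (1 + \<alpha>) *\<^sub>R (yt (Suc k) - y k)" by (simp add: dy yb algebra_simps)
    then have "yt (Suc k) - y k = ?c *\<^sub>R dy k" using c by simp
    then show ?thesis
      using y_model_minimizer[OF H_sym(2) yt, of k] by (simp only: matrix_vector_mult_scaleR)
  qed

  \<comment> \<open>Descent in the two line searches\<close>
  have "tx k \<in> {0..1} \<and> L (x (Suc k), y k, lam k) \<le> L (x k, y k, lam k) - \<rho> * \<gamma> * \<eta>1x * (norm (dx k))\<^sup>2"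
    for k
  proof -
    have "L (x k + t *\<^sub>R dx k, y k, lam k) \<le> L (x k, y k, lam k)
        - t * ?c * sq_norm (cal_Hx A \<beta> ell (Hx k)) (dx k)
        + (Lf + \<beta> * spectral_norm ?AA) / 2 * t\<^sup>2 * (norm (dx k))\<^sup>2" if "t \<in> {0..1}" for t
      using aug_lagrangian_x_descent[where f = f and gradf = gradf and g = g and A = A and \<beta> = \<beta>
          and x = "x k" and d = "dx k" and y = "y k" and l = "lam k", OF f_C1(1) Sx(2) Lf(2) that]
        params(7)
      unfolding optx L_eq by (simp add: sq_norm_def)
    note armijo_step_sufficient_decrease[where F = "\<lambda>z. L (z, y k, lam k)",
        OF params(3,4,1) c(2) \<eta>1x(2) Mx quad_x this \<gamma>0 \<gamma>x]
    then show ?thesis unfolding x_Suc tx by blast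
  qed
  then have tx01: "tx k \<in> {0..1}"
    and xdec: "L (x (Suc k), y k, lam k) \<le> L (x k, y k, lam k) - \<rho> * \<gamma> * \<eta>1x * (norm (dx k))\<^sup>2" for k
    by blast+
  have "ty k \<in> {0..1} \<and> L (x (Suc k), y (Suc k), lamh k)
      \<le> L (x (Suc k), y k, lamh k) - \<rho> * \<gamma> * \<eta>1y * (norm (dy k))\<^sup>2" for k
  proof -
    have "L (x (Suc k), y k + t *\<^sub>R dy k, lamh k) \<le> L (x (Suc k), y k, lamh k)
        - t * ?c * sq_norm (cal_Hy \<beta> \<sigma> (Hy k)) (dy k)
        + (Lg + \<beta>) / 2 * t\<^sup>2 * (norm (dy k))\<^sup>2" if "t \<in> {0..1}" for t
      using aug_lagrangian_y_descent[where f = f and gradg = gradg and g = g and A = A and \<beta> = \<beta>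
          and x = "x (Suc k)" and d = "dy k" and y = "y k" and l = "lamh k",
          OF g_C1(1) Sy(2) Lg(2) that]
      unfolding opty L_eq by (simp add: sq_norm_def)
    note armijo_step_sufficient_decrease[where F = "\<lambda>z. L (x (Suc k), z, lamh k)",
        OF params(3,4,1) c(2) \<eta>1y(2) My quad_y this \<gamma>0 \<gamma>y]
    then show ?thesis unfolding y_Suc ty by blast
  qed
  then have ty01: "ty k \<in> {0..1}"
    and ydec: "L (x (Suc k), y (Suc k), lamh k)
      \<le> L (x (Suc k), y k, lamh k) - \<rho> * \<gamma> * \<eta>1y * (norm (dy k))\<^sup>2" for k
    by blast+
  have xdiff: "norm (x (Suc k) - x k) \<le> norm (dx k)" for k
    using tx01[of k] by (simp add: x_Suc mult_left_le_one_le)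
  have ydiff: "norm (y (Suc k) - y k) \<le> norm (dy k)" for k
    using ty01[of k] by (simp add: y_Suc mult_left_le_one_le)

  \<comment> \<open>Estimates of the multiplier increment\<close>
  define ldiff where "ldiff = (\<lambda>k. (norm (lam (Suc k) - lam k))\<^sup>2)"
  \<comment> \<open>\<open>D\<close> stands for the length of the preceding
    \<open>y\<close>-direction; the six terms follow the order of the six vectors in the splitting
    below.\<close>
  define lbound where "lbound = (\<lambda>k D. 6 * (Lg\<^sup>2 * D\<^sup>2 + E\<^sup>2 * (norm (dy k))\<^sup>2 + E\<^sup>2 * D\<^sup>2
      + \<beta>\<^sup>2 * (1 - s)\<^sup>2 * lambda_max ?AA * (norm (dx k))\<^sup>2 + \<beta>\<^sup>2 * D\<^sup>2 + s\<^sup>2 * \<beta>\<^sup>2 * (norm (dy k))\<^sup>2))"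
  have calHy_le: "norm (?c *\<^sub>R (cal_Hy \<beta> \<sigma> (Hy k) *v v)) \<le> E * norm v" for k v
  proof -
    have "norm (cal_Hy \<beta> \<sigma> (Hy k) *v v) \<le> norm (Hy k *v v) + (\<beta> + \<sigma>) * norm v"
      unfolding cal_Hy_mult using params by (metis norm_scaleR norm_triangle_ineq abs_of_pos add_pos_pos)
    also have "norm (Hy k *v v) \<le> \<eta>y * norm v"
      using norm_matrix_vector_le[of "Hy k" v] H_bound(2)[of k]
      by (meson mult_right_mono norm_ge_zero order_trans)
    finally have "norm (cal_Hy \<beta> \<sigma> (Hy k) *v v) \<le> \<eta>2y * norm v" by (simp add: \<eta>2y algebra_simps)
    then show ?thesis using c by (simp add: E_def divide_right_mono)
  qed
  \<comment> \<open>Optimality in \<open>y\<close> eliminates the old multiplier, so consecutive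
    multipliers can be compared through step data alone.\<close>
  have lam_formula: "lam (Suc k) = - gradg (y k) - ?c *\<^sub>R (cal_Hy \<beta> \<sigma> (Hy k) *v dy k)
      + \<beta> *\<^sub>R (A *v x (Suc k) - y k) - (s * \<beta>) *\<^sub>R (A *v x (Suc k) - y (Suc k))" for k
    using opty[of k] by (simp add: lam_Suc algebra_simps)
  \<comment> \<open>The data \<open>gp\<close>, \<open>q\<close>, \<open>yp\<close> of the preceding \<open>y\<close>-step are kept abstract so that the bound
    also applies at \<open>k = 0\<close>, where that step is the fictitious one of index \<open>-1\<close>.\<close>
  have lam_diff: "ldiff k \<le> lbound k D"
    if lamk: "lam k = - gp - q + \<beta> *\<^sub>R (A *v x k - yp) - (s * \<beta>) *\<^sub>R (A *v x k - y k)"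
      and gp: "norm (gradg (y k) - gp) \<le> Lg * D" and q: "norm q \<le> E * D"
      and yp: "norm (y k - yp) \<le> D"
    for k gp q yp D
  proof -
    \<comment> \<open>The residual terms of both formulas combine: \<open>A\<close> acts only on the
      displacement of \<open>x\<close>, with coefficient \<open>\<beta> * (1 - s)\<close>, which
      explains the factor \<open>(1 - s)\<^sup>2\<close> in \<open>\<delta>x\<close>.\<close>
    have "lam (Suc k) - lam k = - (gradg (y k) - gp) + - (?c *\<^sub>R (cal_Hy \<beta> \<sigma> (Hy k) *v dy k)) + q
        + (\<beta> * (1 - s)) *\<^sub>R (A *v (x (Suc k) - x k)) + - (\<beta> *\<^sub>R (y k - yp))
        + (s * \<beta>) *\<^sub>R (y (Suc k) - y k)"
      unfolding lam_formula lamk by (simp add: algebra_simps matrix_vector_mult_diff_distrib)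
    then have "ldiff k \<le> 6 * ((norm (- (gradg (y k) - gp)))\<^sup>2
        + (norm (- (?c *\<^sub>R (cal_Hy \<beta> \<sigma> (Hy k) *v dy k))))\<^sup>2 + (norm q)\<^sup>2
        + (norm ((\<beta> * (1 - s)) *\<^sub>R (A *v (x (Suc k) - x k))))\<^sup>2 + (norm (- (\<beta> *\<^sub>R (y k - yp))))\<^sup>2
        + (norm ((s * \<beta>) *\<^sub>R (y (Suc k) - y k)))\<^sup>2)"
      unfolding ldiff_def by (simp only: norm_sum_six_squared_le)
    also have "\<dots> \<le> lbound k D"
      unfolding lbound_def
    proof (intro mult_left_mono add_mono)
      show "(norm (- (gradg (y k) - gp)))\<^sup>2 \<le> Lg\<^sup>2 * D\<^sup>2"
        using power_mono[OF gp norm_ge_zero, of 2] by (simp add: power_mult_distrib norm_minus_commute)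
      show "(norm (- (?c *\<^sub>R (cal_Hy \<beta> \<sigma> (Hy k) *v dy k))))\<^sup>2 \<le> E\<^sup>2 * (norm (dy k))\<^sup>2"
        using power_mono[OF calHy_le[of k "dy k"] norm_ge_zero, of 2]
        by (simp only: norm_minus_cancel power_mult_distrib)
      show "(norm q)\<^sup>2 \<le> E\<^sup>2 * D\<^sup>2"
        using power_mono[OF q norm_ge_zero, of 2] by (simp add: power_mult_distrib)
      show "(norm (- (\<beta> *\<^sub>R (y k - yp))))\<^sup>2 \<le> \<beta>\<^sup>2 * D\<^sup>2"
        using power_mono[OF yp norm_ge_zero, of 2] by (simp add: power_mult_distrib mult_left_mono)
      show "(norm ((s * \<beta>) *\<^sub>R (y (Suc k) - y k)))\<^sup>2 \<le> s\<^sup>2 * \<beta>\<^sup>2 * (norm (dy k))\<^sup>2"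
        using power_mono[OF ydiff[of k] norm_ge_zero, of 2]
        by (simp add: power_mult_distrib mult_left_mono)
      have "(norm (A *v (x (Suc k) - x k)))\<^sup>2 = (tx k)\<^sup>2 * (norm (A *v dx k))\<^sup>2"
        by (simp add: x_Suc matrix_vector_mult_scaleR power_mult_distrib)
      also have "\<dots> \<le> 1 * (norm (A *v dx k))\<^sup>2"
        using tx01[of k] by (intro mult_right_mono) (auto simp: power_le_one)
      also have "\<dots> \<le> lambda_max ?AA * (norm (dx k))\<^sup>2"
        using quadratic_form_le_lambda_max[OF AA, of "dx k"] by (simp only: inner_transpose_mult_self mult_1)
      finally have "(\<beta> * (1 - s))\<^sup>2 * (norm (A *v (x (Suc k) - x k)))\<^sup>2
          \<le> (\<beta> * (1 - s))\<^sup>2 * (lambda_max ?AA * (norm (dx k))\<^sup>2)" by (rule mult_left_mono) simp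
      then show "(norm ((\<beta> * (1 - s)) *\<^sub>R (A *v (x (Suc k) - x k))))\<^sup>2
          \<le> \<beta>\<^sup>2 * (1 - s)\<^sup>2 * lambda_max ?AA * (norm (dx k))\<^sup>2"
        by (simp only: norm_scaleR power_mult_distrib power2_abs mult.assoc)
    qed simp
    finally show ?thesis .
  qed
  have y_in_Sy: "y k \<in> Sy" for k using Sy(2)[of 0 k] by simp
  have ldiff_Suc: "ldiff (Suc k) \<le> lbound (Suc k) (norm (dy k))" for k
  proof (rule lam_diff[OF lam_formula])
    have "norm (gradg (y (Suc k)) - gradg (y k)) \<le> Lg * norm (y (Suc k) - y k)"
      using lipschitz_onD[OF Lg(2) y_in_Sy y_in_Sy, of "Suc k" k] by (simp add: dist_norm)
    also have "\<dots> \<le> Lg * norm (dy k)" using Lg(1) ydiff by (intro mult_left_mono) auto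
    finally show "norm (gradg (y (Suc k)) - gradg (y k)) \<le> Lg * norm (dy k)" .
  qed (rule calHy_le ydiff)+

  \<comment> \<open>Descent of the merit function\<close>
  define dyp where "dyp = (\<lambda>k. case k of 0 \<Rightarrow> 0 | Suc j \<Rightarrow> dy j)"
  define V where "V = (\<lambda>k. Lh (wh k))"
  define a where "a = (\<lambda>k. \<delta>x * (norm (dx k))\<^sup>2 + \<delta>y * (norm (dy k))\<^sup>2)"
  have wh': "wh k = (w k, dyp k)" for k by (simp add: wh dyp_def)
  have a0: "0 \<le> a k" for k using \<delta>_pos by (simp add: a_def)
  \<comment> \<open>The multiplier estimate stays a premise: it always holds for successor indices,
    but at \<open>k = 0\<close> it is obtained from the condition on the starting
    multiplier.\<close>
  have descent: "V (Suc k) \<le> V k - a k" if ld: "ldiff k \<le> lbound k (norm (dyp k))" for k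
  proof -
    define X where "X = (norm (dx k))\<^sup>2"
    define Y where "Y = (norm (dy k))\<^sup>2"
    define D where "D = (norm (dyp k))\<^sup>2"
    define R where "R = \<bar>r + s\<bar>"
    have R: "0 < R" using params by (simp add: R_def)
    have V_eq: "V k = L (x k, y k, lam k) + 6 / (R * \<beta>) * (Lg\<^sup>2 + \<beta>\<^sup>2 + E\<^sup>2) * D"
      "V (Suc k) = L (x (Suc k), y (Suc k), lam (Suc k)) + 6 / (R * \<beta>) * (Lg\<^sup>2 + \<beta>\<^sup>2 + E\<^sup>2) * Y"
      by (simp_all add: V_def Lh_eq merit_def wh' w X_def Y_def D_def R_def E_def dyp_def)
    have "L (x (Suc k), y (Suc k), lam (Suc k)) - L (x (Suc k), y (Suc k), lamh k)
      + (L (x (Suc k), y k, lamh k) - L (x (Suc k), y k, lam k))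
      \<le> ldiff k / (R * \<beta>) + \<bar>r * s\<bar> * \<beta> / R * (norm (y (Suc k) - y k))\<^sup>2"
      unfolding L_eq ldiff_def R_def
      by (rule multiplier_updates_increase[OF lamh lam_Suc params(7,10)])
    also have "\<dots> \<le> lbound k (norm (dyp k)) / (R * \<beta>) + \<bar>r * s\<bar> * \<beta> / R * Y"
      using ld R params(7) ydiff[of k] unfolding Y_def
      by (intro add_mono mult_left_mono divide_right_mono power_mono) auto
    finally have "L (x (Suc k), y (Suc k), lam (Suc k)) \<le> L (x k, y k, lam k)
        - \<rho> * \<gamma> * \<eta>1x * X - \<rho> * \<gamma> * \<eta>1y * Y + lbound k (norm (dyp k)) / (R * \<beta>) + \<bar>r * s\<bar> * \<beta> / R * Y"
      using xdec[of k] ydec[of k] unfolding X_def Y_def by linarith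
    \<comment> \<open>The coefficient of \<open>D\<close> is exactly the merit weight, so it cancels
      against the extra term of \<open>V k\<close>. The same weight times \<open>Y\<close>, from
      \<open>V (Suc k)\<close>, joins the remaining losses to form \<open>\<delta>y\<close>.\<close>
    moreover have "lbound k (norm (dyp k)) / (R * \<beta>) = 6 / (R * \<beta>) * (Lg\<^sup>2 + \<beta>\<^sup>2 + E\<^sup>2) * D
        + 6 / (R * \<beta>) * (E\<^sup>2 + s\<^sup>2 * \<beta>\<^sup>2) * Y
        + 6 * (1 - s)\<^sup>2 * \<beta> * lambda_max ?AA / R * X"
      using R params(7) unfolding lbound_def X_def[symmetric] Y_def[symmetric] D_def[symmetric]
      by (simp add: field_simps power2_eq_square)
    moreover have "a k = \<rho> * \<gamma> * \<eta>1x * X - 6 * (1 - s)\<^sup>2 * \<beta> * lambda_max ?AA / R * X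
        + \<rho> * \<gamma> * \<eta>1y * Y - 6 / (R * \<beta>) * (Lg\<^sup>2 + \<beta>\<^sup>2 + E\<^sup>2) * Y
        - 6 / (R * \<beta>) * (E\<^sup>2 + s\<^sup>2 * \<beta>\<^sup>2) * Y - \<bar>r * s\<bar> * \<beta> / R * Y"
      unfolding a_def \<delta>x \<delta>y X_def[symmetric] Y_def[symmetric] R_def[symmetric] E_def[symmetric]
      by (simp add: algebra_simps)
    ultimately show ?thesis unfolding V_eq by linarith
  qed
  have desc_Suc: "V (Suc (Suc k)) \<le> V (Suc k) - a (Suc k)" for k
    using descent[of "Suc k"] ldiff_Suc[of k] by (simp add: dyp_def)

  \<comment> \<open>Continuity of the merit function and boundedness of its arguments\<close>
  have cont_f: "continuous_on UNIV f" and cont_g: "continuous_on UNIV g"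
    using f_C1(1) g_C1(1) unfolding gderiv_def
    by (meson continuous_at_imp_continuous_on has_derivative_continuous)+
  have "continuous_on UNIV (\<lambda>p. f (fst (fst p)))" "continuous_on UNIV (\<lambda>p. g (fst (snd (fst p))))"
    by (auto intro!: continuous_on_compose2[OF cont_f] continuous_on_compose2[OF cont_g] continuous_intros)
  then have cont: "continuous_on UNIV Lh"
    unfolding Lh_eq merit_def L_eq aug_lagrangian_def case_prod_unfold
    by (intro continuous_intros
        continuous_on_compose2[OF linear_continuous_on[OF matrix_vector_mul_bounded_linear]]) auto
  have bdd_Sy: "bounded ((\<lambda>(u, v). u - v) ` (Sy \<times> Sy))"
    by (intro compact_imp_bounded compact_continuous_image compact_Times Sy(1))
       (auto simp: case_prod_unfold intro!: continuous_intros)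
  \<comment> \<open>Each \<open>dy j\<close> is the difference of the segment endpoints
    \<open>y j + dy j\<close> and \<open>y j\<close>, both in the compact set \<open>Sy\<close>; the
    inserted 0 is the direction of index -1.\<close>
  have "range dyp \<subseteq> insert 0 ((\<lambda>(u, v). u - v) ` (Sy \<times> Sy))"
  proof
    fix v assume "v \<in> range dyp"
    then obtain k where v: "v = dyp k" by blast
    show "v \<in> insert 0 ((\<lambda>(u, v). u - v) ` (Sy \<times> Sy))"
    proof (cases k)
      case (Suc j)
      have "(y j + 1 *\<^sub>R dy j, y j) \<in> Sy \<times> Sy" using Sy(2)[of 1 j] y_in_Sy by auto
      then show ?thesis using v Suc by (force simp: dyp_def)
    qed (simp add: v dyp_def)
  qed
  then have "bounded (range dyp)" using bdd_Sy by (meson bounded_insert bounded_subset)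
  with w_bounded have "bounded (range w \<times> range dyp)" by (rule bounded_Times)
  then have wh_bounded: "bounded (range wh)" by (rule bounded_subset) (auto simp: wh')
  \<comment> \<open>A continuous function on the compact closure of the sequence is bounded
    below.\<close>
  have "compact (Lh ` closure (range wh))"
    using wh_bounded cont by (intro compact_continuous_image) (auto intro: continuous_on_subset)
  then have "bdd_below (Lh ` closure (range wh))" by (intro bounded_imp_bdd_below compact_imp_bounded)
  then have V_bdd: "bdd_below (range V)"
    by (rule bdd_below_mono) (auto simp: V_def intro!: imageI closure_subset[THEN subsetD])
  then have VS_bdd: "bdd_below (range (\<lambda>k. V (Suc k)))" by (rule bdd_below_mono) auto

  \<comment> \<open>Convergence of the merit values\<close>
  note suff = sufficient_decrease[of "\<lambda>k. V (Suc k)" "\<lambda>k. a (Suc k)", OF desc_Suc a0 VS_bdd]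
  have INF_Suc: "(INF k. V (Suc k)) = (INF k\<in>{1..}. V k)"
  proof -
    have "{1..} = range Suc" by (auto simp: Suc_le_eq gr0_conv_Suc)
    then have "V ` {1..} = range (\<lambda>k. V (Suc k))" by (simp only: image_image)
    then show ?thesis by simp
  qed
  have V_lim: "V \<longlonglongrightarrow> (INF k\<in>{1..}. V k)"
    using suff(1) unfolding INF_Suc by (rule LIMSEQ_imp_Suc)
  have lim_V: "lim V = (INF k\<in>{1..}. V k)" using V_lim by (rule limI)
  have part_i: "lim V = (INF k. V k)"
    if start: "y_step_at_minus_one A \<beta> \<sigma> s (gradg (y 0)) (Hy 0) (x 0) (y 0) (lam 0)"
  proof -
    obtain lh where lh: "is_arg_min (y_model A \<beta> \<sigma> (gradg (y 0)) (Hy 0) (x 0) (y 0) lh) (\<lambda>_. True) (y 0)"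
      and lam0: "lam 0 = lh - (s * \<beta>) *\<^sub>R (A *v x 0 - y 0)"
      using start unfolding y_step_at_minus_one_def by blast
    have "gradg (y 0) + lh - \<beta> *\<^sub>R (A *v x 0 - y 0) = 0"
      using y_model_minimizer[OF H_sym(2) lh] by simp
    then have "lh = - gradg (y 0) + \<beta> *\<^sub>R (A *v x 0 - y 0)" by (simp add: algebra_simps add_eq_0_iff)
    \<comment> \<open>The fictitious step does not move: its gradient is \<open>gradg (y 0)\<close>,
      its matrix term \<open>q\<close> is 0, its base point is \<open>y 0\<close>, and
      \<open>D = 0\<close>.\<close>
    then have "ldiff 0 \<le> lbound 0 (norm (dyp 0))"
      using lam0 by (intro lam_diff[of 0 "gradg (y 0)" 0 "y 0"]) (auto simp: dyp_def)
    then have "V (Suc k) \<le> V k - a k" for k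
      using descent desc_Suc by (cases k) auto
    then have "V \<longlonglongrightarrow> (INF k. V k)" using a0 V_bdd by (rule sufficient_decrease)
    then show ?thesis by (rule limI)
  qed
  have Lh_cluster: "Lh p = lim V" if "p \<in> \<Omega>h" for p
  proof -
    obtain \<phi> where \<phi>: "strict_mono \<phi>" "(wh \<circ> \<phi>) \<longlonglongrightarrow> p"
      using \<open>p \<in> \<Omega>h\<close> by (auto simp: \<Omega>h cluster_points_def)
    have "(\<lambda>k. Lh ((wh \<circ> \<phi>) k)) \<longlonglongrightarrow> Lh p"
      using continuous_on_tendsto_compose[OF cont \<phi>(2)] by simp
    moreover have "(V \<circ> \<phi>) \<longlonglongrightarrow> lim V"
      using V_lim \<phi>(1) unfolding lim_V by (rule LIMSEQ_subseq_LIMSEQ)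
    ultimately show ?thesis by (intro LIMSEQ_unique[of "V \<circ> \<phi>"]) (simp_all add: V_def o_def)
  qed

  \<comment> \<open>Square summability of directions and displacements\<close>
  have "summable (\<lambda>k. (norm (dx k))\<^sup>2)"
  proof -
    have "summable (\<lambda>k. (norm (dx (Suc k)))\<^sup>2)"
      by (rule summable_comparison_test'[OF summable_mult[OF suff(2), of "1 / \<delta>x"], of 0])
         (use \<delta>_pos in \<open>auto simp: a_def field_simps\<close>)
    then show ?thesis by (subst (asm) summable_Suc_iff)
  qed
  have "summable (\<lambda>k. (norm (dy k))\<^sup>2)"
  proof -
    have "summable (\<lambda>k. (norm (dy (Suc k)))\<^sup>2)"
      by (rule summable_comparison_test'[OF summable_mult[OF suff(2), of "1 / \<delta>y"], of 0])
         (use \<delta>_pos in \<open>auto simp: a_def field_simps\<close>)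
    then show ?thesis by (subst (asm) summable_Suc_iff)
  qed
  note sum_d = \<open>summable (\<lambda>k. (norm (dx k))\<^sup>2)\<close> this
  have null: "v \<longlonglongrightarrow> 0" if "summable (\<lambda>k. (norm (v k))\<^sup>2)" for v :: "nat \<Rightarrow> 'z::real_normed_vector"
    using summable_LIMSEQ_zero[OF that] tendsto_norm_zero_iff[of v] by simp
  have dx0: "dx \<longlonglongrightarrow> 0" and dy0: "dy \<longlonglongrightarrow> 0" using sum_d by (auto intro: null)
  have sum_l: "summable ldiff"
  proof -
    have "summable (\<lambda>k. (norm (dx (Suc k)))\<^sup>2)" "summable (\<lambda>k. (norm (dy (Suc k)))\<^sup>2)"
      using sum_d by (auto simp: summable_Suc_iff[of "\<lambda>k. (norm (dx k))\<^sup>2"] summable_Suc_iff[of "\<lambda>k. (norm (dy k))\<^sup>2"])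
    then have "summable (\<lambda>k. lbound (Suc k) (norm (dy k)))"
      unfolding lbound_def by (intro summable_mult summable_add sum_d)
    then have "summable (\<lambda>k. ldiff (Suc k))"
      by (rule summable_comparison_test'[of _ 0]) (use ldiff_Suc in \<open>auto simp: ldiff_def\<close>)
    then show ?thesis by (subst (asm) summable_Suc_iff)
  qed
  have sum_x: "summable (\<lambda>k. (norm (x (Suc k) - x k))\<^sup>2)"
    by (rule summable_comparison_test'[OF sum_d(1), of 0]) (simp add: xdiff power_mono)
  have sum_y: "summable (\<lambda>k. (norm (y (Suc k) - y k))\<^sup>2)"
    by (rule summable_comparison_test'[OF sum_d(2), of 0]) (simp add: ydiff power_mono)
  have sum_w: "summable (\<lambda>k. (norm (w (Suc k) - w k))\<^sup>2)"
    using summable_add[OF sum_x summable_add[OF sum_y sum_l]]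
    by (simp add: w norm_Pair ldiff_def)

  \<comment> \<open>Cluster points and their stationarity\<close>
  have dyp0: "dyp \<longlonglongrightarrow> 0"
    by (rule LIMSEQ_imp_Suc) (simp add: dyp_def dy0)
  have \<Omega>h_eq: "\<Omega>h = \<Omega> \<times> {0}"
    unfolding \<Omega>h \<Omega> using cluster_points_Pair_convergent[OF dyp0, of w] by (simp add: wh'[abs_def])

  have crit: "\<Omega> \<subseteq> crit L"
  proof
    fix p assume "p \<in> \<Omega>"
    then obtain \<phi> xs ys ls where p: "p = (xs, ys, ls)" and \<phi>: "strict_mono \<phi>" "(w \<circ> \<phi>) \<longlonglongrightarrow> (xs, ys, ls)"
      unfolding \<Omega> cluster_points_def by (cases p) auto
    have xs: "(\<lambda>k. x (\<phi> k)) \<longlonglongrightarrow> xs" and ys: "(\<lambda>k. y (\<phi> k)) \<longlonglongrightarrow> ys"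
      and ls: "(\<lambda>k. lam (\<phi> k)) \<longlonglongrightarrow> ls"
      using tendsto_fst[OF \<phi>(2)] tendsto_fst[OF tendsto_snd[OF \<phi>(2)]] tendsto_snd[OF tendsto_snd[OF \<phi>(2)]]
      by (simp_all add: w o_def)
    note sub = LIMSEQ_subseq_LIMSEQ[OF _ \<phi>(1), unfolded o_def]
    have Aconv: "(\<lambda>k. B *v v k) \<longlonglongrightarrow> B *v l" if "v \<longlonglongrightarrow> l" for v l and B :: "real^'i^'j"
      by (rule bounded_linear.tendsto[OF matrix_vector_mul_bounded_linear that])
    have dx_lim: "(\<lambda>k. x (Suc k) - x k) \<longlonglongrightarrow> 0" and dy_lim: "(\<lambda>k. y (Suc k) - y k) \<longlonglongrightarrow> 0"
      using sum_x sum_y by (auto intro: null)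
    have dl_lim: "(\<lambda>k. lam (Suc k) - lam k) \<longlonglongrightarrow> 0"
      using sum_l unfolding ldiff_def by (rule null)
    \<comment> \<open>The residual at \<open>x (Suc k)\<close> and \<open>y k\<close> is solved for
      from the multiplier increment: replacing the residual at \<open>y (Suc k)\<close> costs a
      displacement of \<open>y\<close>, and division by \<open>r + s\<close> is possible.\<close>
    have "(\<lambda>k. (1 / (r + s)) *\<^sub>R (s *\<^sub>R (y (Suc k) - y k) - (1 / \<beta>) *\<^sub>R (lam (Suc k) - lam k))) \<longlonglongrightarrow>
        (1 / (r + s)) *\<^sub>R (s *\<^sub>R 0 - (1 / \<beta>) *\<^sub>R 0)"
      by (intro tendsto_intros dy_lim dl_lim)
    moreover have "(1 / (r + s)) *\<^sub>R (s *\<^sub>R (y (Suc k) - y k) - (1 / \<beta>) *\<^sub>R (lam (Suc k) - lam k))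
        = A *v x (Suc k) - y k" for k
    proof -
      have "lam (Suc k) - lam k = - (\<beta> *\<^sub>R (r *\<^sub>R (A *v x (Suc k) - y k) + s *\<^sub>R (A *v x (Suc k) - y (Suc k))))"
        by (simp add: lam_Suc lamh algebra_simps)
      then have "(1 / \<beta>) *\<^sub>R (lam (Suc k) - lam k)
          = - (r *\<^sub>R (A *v x (Suc k) - y k) + s *\<^sub>R (A *v x (Suc k) - y (Suc k)))"
        using params(7) by simp
      then have "s *\<^sub>R (y (Suc k) - y k) - (1 / \<beta>) *\<^sub>R (lam (Suc k) - lam k)
          = (r + s) *\<^sub>R (A *v x (Suc k) - y k)"
        by (simp only:) (simp add: algebra_simps)
      then show ?thesis using params(10) by simp
    qed
    ultimately have res: "(\<lambda>k. A *v x (Suc k) - y k) \<longlonglongrightarrow> 0" by simp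
    have "(\<lambda>k. (A *v x (Suc k) - y k) - A *v (x (Suc k) - x k)) \<longlonglongrightarrow> 0 - A *v 0"
      by (intro tendsto_diff res Aconv dx_lim)
    then have "(\<lambda>k. A *v x k - y k) \<longlonglongrightarrow> 0" by (simp add: matrix_vector_mult_diff_distrib)
    from sub[OF this] have res_sub: "(\<lambda>k. A *v x (\<phi> k) - y (\<phi> k)) \<longlonglongrightarrow> 0" .
    moreover have "(\<lambda>k. A *v x (\<phi> k) - y (\<phi> k)) \<longlonglongrightarrow> A *v xs - ys"
      by (intro tendsto_diff Aconv xs ys)
    ultimately have feas: "A *v xs - ys = 0" by (rule LIMSEQ_unique[rotated])

    \<comment> \<open>The matrices vary with \<open>k\<close> and need not converge; their uniform
      norm bound suffices, since the directions vanish. By \<open>optx\<close> the partial gradient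
      in \<open>x\<close> then vanishes too.\<close>
    have "(\<lambda>k. - (?c *\<^sub>R (cal_Hx A \<beta> ell (Hx k) *v dx k))) \<longlonglongrightarrow> 0"
    proof (rule Lim_null_comparison)
      have "norm (Hx k *v dx k) \<le> \<eta>x * norm (dx k)" for k
        using norm_matrix_vector_le[of "Hx k" "dx k"] H_bound(1)[of k]
        by (meson mult_right_mono norm_ge_zero order_trans)
      moreover have "norm (cal_Hx A \<beta> ell (Hx k) *v dx k) \<le> norm (Hx k *v dx k)
          + \<beta> * norm (transpose A *v (A *v dx k)) + ell * norm (dx k)" for k
        unfolding cal_Hx_mult using params(7,8)
        by (intro order_trans[OF norm_triangle_ineq] add_mono) (auto intro: order_trans[OF norm_triangle_ineq])
      ultimately have "norm (- (?c *\<^sub>R (cal_Hx A \<beta> ell (Hx k) *v dx k)))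
        \<le> ?c * (\<eta>x * norm (dx k) + \<beta> * norm (transpose A *v (A *v dx k)) + ell * norm (dx k))" for k
        using c(1) by (simp only: norm_minus_cancel norm_scaleR abs_of_pos)
          (intro mult_left_mono, smt (verit), simp)
      then show "\<forall>\<^sub>F k in sequentially. norm (- (?c *\<^sub>R (cal_Hx A \<beta> ell (Hx k) *v dx k)))
        \<le> ?c * (\<eta>x * norm (dx k) + \<beta> * norm (transpose A *v (A *v dx k)) + ell * norm (dx k))"
        by (intro always_eventually allI)
      have "(\<lambda>k. ?c * (\<eta>x * norm (dx k) + \<beta> * norm (transpose A *v (A *v dx k)) + ell * norm (dx k)))
        \<longlonglongrightarrow> ?c * (\<eta>x * norm (0::real^'n) + \<beta> * norm (transpose A *v (A *v 0)) + ell * norm (0::real^'n))"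
        by (intro tendsto_intros Aconv dx0)
      then show "(\<lambda>k. ?c * (\<eta>x * norm (dx k) + \<beta> * norm (transpose A *v (A *v dx k)) + ell * norm (dx k)))
        \<longlonglongrightarrow> 0" by simp
    qed
    then have "(\<lambda>k. gradf (x k) - transpose A *v lam k + \<beta> *\<^sub>R (transpose A *v (A *v x k - y k))) \<longlonglongrightarrow> 0"
      by (simp only: optx)
    from sub[OF this]
    have "(\<lambda>k. gradf (x (\<phi> k)) - transpose A *v lam (\<phi> k)
        + \<beta> *\<^sub>R (transpose A *v (A *v x (\<phi> k) - y (\<phi> k)))) \<longlonglongrightarrow> 0" .
    moreover have "(\<lambda>k. gradf (x (\<phi> k)) - transpose A *v lam (\<phi> k)
        + \<beta> *\<^sub>R (transpose A *v (A *v x (\<phi> k) - y (\<phi> k))))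
        \<longlonglongrightarrow> gradf xs - transpose A *v ls + \<beta> *\<^sub>R (transpose A *v 0)"
      by (intro tendsto_intros Aconv ls res_sub continuous_on_tendsto_compose[OF f_C1(2) xs]) auto
    ultimately have "gradf xs - transpose A *v ls + \<beta> *\<^sub>R (transpose A *v 0) = 0"
      by (rule LIMSEQ_unique[rotated])
    then have statx: "gradf xs - transpose A *v ls = 0"
      by (simp only: matrix_vector_mult_0_right scaleR_zero_right add_0_right)

    have "(\<lambda>k. - (?c *\<^sub>R (cal_Hy \<beta> \<sigma> (Hy k) *v dy k))) \<longlonglongrightarrow> 0"
    proof (rule Lim_null_comparison)
      show "\<forall>\<^sub>F k in sequentially. norm (- (?c *\<^sub>R (cal_Hy \<beta> \<sigma> (Hy k) *v dy k))) \<le> E * norm (dy k)"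
        by (simp only: norm_minus_cancel calHy_le eventually_True)
      show "(\<lambda>k. E * norm (dy k)) \<longlonglongrightarrow> 0" using tendsto_mult_right_zero[OF tendsto_norm_zero[OF dy0]] .
    qed
    then have "(\<lambda>k. gradg (y k) + lamh k - \<beta> *\<^sub>R (A *v x (Suc k) - y k)) \<longlonglongrightarrow> 0"
      by (simp only: opty)
    \<comment> \<open>Adding this multiple of the vanishing residual removes the penalty term and
      turns \<open>lamh k\<close> back into \<open>lam k\<close>.\<close>
    then have "(\<lambda>k. (gradg (y k) + lamh k - \<beta> *\<^sub>R (A *v x (Suc k) - y k))
        + (\<beta> + r * \<beta>) *\<^sub>R (A *v x (Suc k) - y k)) \<longlonglongrightarrow> 0 + (\<beta> + r * \<beta>) *\<^sub>R 0"
      by (intro tendsto_intros res)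
    then have "(\<lambda>k. gradg (y k) + lam k) \<longlonglongrightarrow> 0" by (simp add: lamh algebra_simps)
    from sub[OF this] have "(\<lambda>k. gradg (y (\<phi> k)) + lam (\<phi> k)) \<longlonglongrightarrow> 0" .
    moreover have "(\<lambda>k. gradg (y (\<phi> k)) + lam (\<phi> k)) \<longlonglongrightarrow> gradg ys + ls"
      by (intro tendsto_intros ls continuous_on_tendsto_compose[OF g_C1(2) ys]) auto
    ultimately have staty: "gradg ys + ls = 0" by (rule LIMSEQ_unique[rotated])
    show "p \<in> crit L"
      using GDERIV_aug_lagrangian[OF f_C1(1) g_C1(1), of A \<beta> xs ys ls]
      unfolding crit_def p L_eq feas statx staty by (simp add: zero_prod_def)
  qed

  \<comment> \<open>Assembly of the five conclusions\<close>
  have "convergent (\<lambda>k. Lh (wh k))" using V_lim unfolding V_def convergent_def by blast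
  moreover have "Lh constant_on \<Omega>h" using Lh_cluster unfolding constant_on_def by blast
  moreover have "\<Omega>h = {((xs, ys, ls), 0) | xs ys ls. (xs, ys, ls) \<in> \<Omega>}" unfolding \<Omega>h_eq by auto
  ultimately show ?thesis
    using V_bdd Lh_cluster lim_V part_i tendsto_norm_zero[OF dx0] tendsto_norm_zero[OF dy0] sum_w crit \<Omega>h_eq
      cluster_points_nonempty[OF w_bounded] compact_cluster_points[OF w_bounded]
      cluster_points_nonempty[OF wh_bounded] compact_cluster_points[OF wh_bounded]
      infdist_cluster_points_tendsto_0[OF w_bounded] infdist_cluster_points_tendsto_0[OF wh_bounded]
    unfolding V_def \<Omega>[symmetric] \<Omega>h[symmetric] by (intro conjI) auto
qed

end
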